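(* Let $(\Omega,\Sigma)$ be a measurable space. Every $B(\Omega)$-module $L_p(\Omega,\mu)$, with $p\in[1,+\infty]$ and $\mu\in M(\Omega)$, is relatively projective, metrically projective and extremely projective in the category $\mathscr{L}$.
   Context: All linear spaces are over $\mathbb{C}$. $B(\Omega)$ is the Banach algebra of bounded measurable functions on $(\Omega,\Sigma)$ with the sup-norm. $M(\Omega)$ is the space of finite complex-valued $\sigma$-additive measures on $(\Omega,\Sigma)$; for complex $\mu$, $L_p(\Omega,\mu)$ is understood as $L_p(\Omega,|\mu|)$. Each $L_p(\Omega,\mu)$ is a left Banach $B(\Omega)$-module under pointwise multiplication $b\cdot f$. $\mathscr{L}$ is the full subcategory of the category of left Banach $B(\Omega)$-modules (morphisms: bounded $B(\Omega)$-module maps) whose objects are the modules $L_p(\Omega,\mu)$, $p\in[1,+\infty]$, $\mu\in M(\Omega)$. $\mathscr{L}_1$ has the same objects but only contractive morphisms (norm $\leq1$). $\operatorname{Hom}_{\mathscr{L}}(X,Y)$ carries the operator norm. For a bounded operator $T:X\to Y$ between normed spaces: $T$ is topologically surjective if there is $c>0$ such that for every $y\in Y$ there is $x$ with $T(x)=y$ and $\|x\|\leq c\|y\|$; coisometric if it is contractive and for every $c'>1$ and $y\in Y$ there is $x$ with $T(x)=y$ and $\|x\|<c'\|y\|$ (for $y=0$ take $x=0$); strictly coisometric if it is contractive and for every $y\in Y$ there is $x$ with $T(x)=y$ and $\|x\|\leq\|y\|$. A morphism is a relatively / metrically / extremely admissible epimorphism if it is topologically surjective / strictly coisometric / coisometric,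 respectively. An object $P$ of $\mathscr{L}$ is relatively / metrically / extremely projective in $\mathscr{L}$ if for every relatively / metrically / extremely admissible epimorphism $\pi:Y\to X$ in $\mathscr{L}$ / $\mathscr{L}_1$ / $\mathscr{L}_1$, the operator $\operatorname{Hom}_{\mathscr{L}}(P,\pi):\operatorname{Hom}_{\mathscr{L}}(P,Y)\to\operatorname{Hom}_{\mathscr{L}}(P,X)$, $\psi\mapsto\pi\psi$, is surjective / strictly coisometric / coisometric, respectively. *)

theory Defs
  imports "HOL-Probability.Essential_Supremum" "HOL-Library.FuncSet"
begin

text \<open>
  Throughout, a measurable space \<open>(\<Omega>, \<Sigma>)\<close> is given by a value \<open>M :: 'a measure\<close>, of which
  only \<open>space M\<close> and \<open>sets M\<close> are used; the measure that \<open>M\<close> itself carries plays no role.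
\<close>

section \<open>Normed spaces with explicit carrier\<close>

record 'v nspace =
  vcarrier :: "'v set"
  vzero :: 'v
  vadd :: "'v \<Rightarrow> 'v \<Rightarrow> 'v"
  vscale :: "complex \<Rightarrow> 'v \<Rightarrow> 'v"
  vnorm :: "'v \<Rightarrow> real"

text \<open>
  Operators are extensional functions on the carrier, so that two operators that agree on the
  carrier are equal.
\<close>

definition bounded_op ::
  "('v, 'r) nspace_scheme \<Rightarrow> ('w, 's) nspace_scheme \<Rightarrow> ('v \<Rightarrow> 'w) \<Rightarrow> bool" where
  "bounded_op X Y T \<longleftrightarrow>
     T \<in> vcarrier X \<rightarrow>\<^sub>E vcarrier Y \<and>
     (\<forall>x\<in>vcarrier X. \<forall>y\<in>vcarrier X. T (vadd X x y) = vadd Y (T x) (T y)) \<and>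
     (\<forall>c. \<forall>x\<in>vcarrier X. T (vscale X c x) = vscale Y c (T x)) \<and>
     (\<exists>C. \<forall>x\<in>vcarrier X. vnorm Y (T x) \<le> C * vnorm X x)"

definition op_norm ::
  "('v, 'r) nspace_scheme \<Rightarrow> ('w, 's) nspace_scheme \<Rightarrow> ('v \<Rightarrow> 'w) \<Rightarrow> real" where
  "op_norm X Y T = (SUP x\<in>{x \<in> vcarrier X. vnorm X x \<le> 1}. vnorm Y (T x))"

definition contractive ::
  "('v, 'r) nspace_scheme \<Rightarrow> ('w, 's) nspace_scheme \<Rightarrow> ('v \<Rightarrow> 'w) \<Rightarrow> bool" where
  "contractive X Y T \<longleftrightarrow> bounded_op X Y T \<and> op_norm X Y T \<le> 1"

definition topologically_surjective ::
  "('v, 'r) nspace_scheme \<Rightarrow> ('w, 's) nspace_scheme \<Rightarrow> ('v \<Rightarrow> 'w) \<Rightarrow> bool" where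
  "topologically_surjective X Y T \<longleftrightarrow>
     bounded_op X Y T \<and>
     (\<exists>c>0. \<forall>y\<in>vcarrier Y. \<exists>x\<in>vcarrier X. T x = y \<and> vnorm X x \<le> c * vnorm Y y)"

text \<open>
  The strict inequality below cannot hold for \<open>y = 0\<close>, where \<open>x = 0\<close> is taken instead.
\<close>

definition coisometric ::
  "('v, 'r) nspace_scheme \<Rightarrow> ('w, 's) nspace_scheme \<Rightarrow> ('v \<Rightarrow> 'w) \<Rightarrow> bool" where
  "coisometric X Y T \<longleftrightarrow>
     contractive X Y T \<and>
     (\<forall>c'>1. \<forall>y\<in>vcarrier Y. \<exists>x\<in>vcarrier X.
        T x = y \<and> (vnorm X x < c' * vnorm Y y \<or> (x = vzero X \<and> y = vzero Y)))"

definition strictly_coisometric ::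
  "('v, 'r) nspace_scheme \<Rightarrow> ('w, 's) nspace_scheme \<Rightarrow> ('v \<Rightarrow> 'w) \<Rightarrow> bool" where
  "strictly_coisometric X Y T \<longleftrightarrow>
     contractive X Y T \<and>
     (\<forall>y\<in>vcarrier Y. \<exists>x\<in>vcarrier X. T x = y \<and> vnorm X x \<le> vnorm Y y)"


section \<open>Modules over the bounded measurable functions\<close>

text \<open>
  Elements of \<open>bounded_functions M\<close> are total functions on \<open>'a\<close>; their values outside \<open>space M\<close>
  are arbitrary and do not influence the action on \<open>L\<^sub>p\<close>.
\<close>

definition bounded_functions :: "'a measure \<Rightarrow> ('a \<Rightarrow> complex) set" where
  "bounded_functions M = {b \<in> borel_measurable M. bounded (b ` space M)}"

record ('a, 'v) fmodule = "'v nspace" +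
  act :: "('a \<Rightarrow> complex) \<Rightarrow> 'v \<Rightarrow> 'v"

definition module_hom ::
  "'a measure \<Rightarrow> ('a, 'v) fmodule \<Rightarrow> ('a, 'w) fmodule \<Rightarrow> ('v \<Rightarrow> 'w) set" where
  "module_hom M X Y =
     {T. bounded_op X Y T \<and>
         (\<forall>b\<in>bounded_functions M. \<forall>x\<in>vcarrier X. T (act X b x) = act Y b (T x))}"

definition hom_space ::
  "'a measure \<Rightarrow> ('a, 'v) fmodule \<Rightarrow> ('a, 'w) fmodule \<Rightarrow> ('v \<Rightarrow> 'w) nspace" where
  "hom_space M X Y =
     \<lparr>vcarrier = module_hom M X Y,
      vzero = (\<lambda>x\<in>vcarrier X. vzero Y),
      vadd = (\<lambda>\<phi> \<psi>. \<lambda>x\<in>vcarrier X. vadd Y (\<phi> x) (\<psi> x)),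
      vscale = (\<lambda>c \<phi>. \<lambda>x\<in>vcarrier X. vscale Y c (\<phi> x)),
      vnorm = op_norm X Y\<rparr>"

definition hom_map ::
  "'a measure \<Rightarrow> ('a, 'u) fmodule \<Rightarrow> ('a, 'v) fmodule \<Rightarrow> ('v \<Rightarrow> 'w) \<Rightarrow> ('u \<Rightarrow> 'v) \<Rightarrow> ('u \<Rightarrow> 'w)" where
  "hom_map M P Y \<pi> = (\<lambda>\<psi>\<in>module_hom M P Y. compose (vcarrier P) \<pi> \<psi>)"


section \<open>Complex measures and \<open>L\<^sub>p\<close>-modules\<close>

text \<open>
  The values of \<open>\<mu>\<close> outside \<open>sets M\<close> are irrelevant. Taking all \<open>A i\<close> empty gives \<open>\<mu> {} = 0\<close>.
\<close>

definition complex_measures :: "'a measure \<Rightarrow> ('a set \<Rightarrow> complex) set" where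
  "complex_measures M =
     {\<mu>. \<forall>A::nat \<Rightarrow> 'a set. range A \<subseteq> sets M \<longrightarrow> disjoint_family A \<longrightarrow>
           (\<lambda>i. \<mu> (A i)) sums \<mu> (\<Union>i. A i)}"

text \<open>
  The total variation \<open>|\<mu>|\<close>, as the supremum over countable measurable partitions.
\<close>

definition total_variation :: "'a measure \<Rightarrow> ('a set \<Rightarrow> complex) \<Rightarrow> 'a measure" where
  "total_variation M \<mu> =
     measure_of (space M) (sets M)
       (\<lambda>A. SUP E\<in>{E::nat \<Rightarrow> 'a set. range E \<subseteq> sets M \<and> disjoint_family E \<and> (\<Union>i. E i) = A}.
              \<Sum>i. ennreal (cmod (\<mu> (E i))))"

text \<open>The exponent \<open>p = \<infinity>\<close> is represented by \<open>top\<close>.\<close>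

definition lp_functions :: "'a measure \<Rightarrow> ennreal \<Rightarrow> ('a \<Rightarrow> complex) set" where
  "lp_functions N p =
     {f \<in> borel_measurable N.
        if p = top then esssup N (\<lambda>x. ennreal (cmod (f x))) < top
        else integrable N (\<lambda>x. cmod (f x) powr enn2real p)}"

definition lp_norm :: "'a measure \<Rightarrow> ennreal \<Rightarrow> ('a \<Rightarrow> complex) \<Rightarrow> real" where
  "lp_norm N p f =
     (if p = top then enn2real (esssup N (\<lambda>x. ennreal (cmod (f x))))
      else (LINT x|N. cmod (f x) powr enn2real p) powr (1 / enn2real p))"

definition ae_rel :: "'a measure \<Rightarrow> ennreal \<Rightarrow> (('a \<Rightarrow> complex) \<times> ('a \<Rightarrow> complex)) set" where
  "ae_rel N p =
     {(f, g). f \<in> lp_functions N p \<and> g \<in> lp_functions N p \<and> (AE x in N. f x = g x)}"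

text \<open>
  Vectors are equivalence classes of functions. The operations and the norm do not depend on the
  choice of representatives: each union below is a union of copies of one class, and
  \<open>the_elem\<close> is applied to a singleton.
\<close>

definition Lp_of :: "'a measure \<Rightarrow> ennreal \<Rightarrow> ('a, ('a \<Rightarrow> complex) set) fmodule" where
  "Lp_of N p =
     \<lparr>vcarrier = lp_functions N p // ae_rel N p,
      vzero = ae_rel N p `` {\<lambda>x. 0},
      vadd = (\<lambda>F G. \<Union>f\<in>F. \<Union>g\<in>G. ae_rel N p `` {\<lambda>x. f x + g x}),
      vscale = (\<lambda>c F. \<Union>f\<in>F. ae_rel N p `` {\<lambda>x. c * f x}),
      vnorm = (\<lambda>F. the_elem (lp_norm N p ` F)),
      act = (\<lambda>b F. \<Union>f\<in>F. ae_rel N p `` {\<lambda>x. b x * f x})\<rparr>"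

definition Lp_module ::
  "'a measure \<Rightarrow> ennreal \<Rightarrow> ('a set \<Rightarrow> complex) \<Rightarrow> ('a, ('a \<Rightarrow> complex) set) fmodule" where
  "Lp_module M p \<mu> = Lp_of (total_variation M \<mu>) p"


section \<open>The categories of \<open>L\<^sub>p\<close>-modules and projectivity\<close>

text \<open>
  Both categories have the same objects. \<open>module_hom M X Y\<close> is the set of morphisms of the full
  subcategory, \<open>contractive_hom M X Y\<close> that of its non-full version.
\<close>

definition Lp_objects :: "'a measure \<Rightarrow> ('a, ('a \<Rightarrow> complex) set) fmodule set" where
  "Lp_objects M = {Lp_module M p \<mu> | p \<mu>. 1 \<le> p \<and> \<mu> \<in> complex_measures M}"

definition contractive_hom ::
  "'a measure \<Rightarrow> ('a, 'v) fmodule \<Rightarrow> ('a, 'w) fmodule \<Rightarrow> ('v \<Rightarrow> 'w) set" where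
  "contractive_hom M X Y = {T \<in> module_hom M X Y. contractive X Y T}"

definition relatively_projective ::
  "'a measure \<Rightarrow> ('a, ('a \<Rightarrow> complex) set) fmodule \<Rightarrow> bool" where
  "relatively_projective M P \<longleftrightarrow>
     P \<in> Lp_objects M \<and>
     (\<forall>Y\<in>Lp_objects M. \<forall>X\<in>Lp_objects M. \<forall>\<pi>\<in>module_hom M Y X.
        topologically_surjective Y X \<pi> \<longrightarrow>
        hom_map M P Y \<pi> ` module_hom M P Y = module_hom M P X)"

definition metrically_projective ::
  "'a measure \<Rightarrow> ('a, ('a \<Rightarrow> complex) set) fmodule \<Rightarrow> bool" where
  "metrically_projective M P \<longleftrightarrow>
     P \<in> Lp_objects M \<and>
     (\<forall>Y\<in>Lp_objects M. \<forall>X\<in>Lp_objects M. \<forall>\<pi>\<in>contractive_hom M Y X.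
        strictly_coisometric Y X \<pi> \<longrightarrow>
        strictly_coisometric (hom_space M P Y) (hom_space M P X) (hom_map M P Y \<pi>))"

definition extremely_projective ::
  "'a measure \<Rightarrow> ('a, ('a \<Rightarrow> complex) set) fmodule \<Rightarrow> bool" where
  "extremely_projective M P \<longleftrightarrow>
     P \<in> Lp_objects M \<and>
     (\<forall>Y\<in>Lp_objects M. \<forall>X\<in>Lp_objects M. \<forall>\<pi>\<in>contractive_hom M Y X.
        coisometric Y X \<pi> \<longrightarrow>
        coisometric (hom_space M P Y) (hom_space M P X) (hom_map M P Y \<pi>))"

end

theory Submission
  imports Defs
begin

text \<open>
  Projectivity of all objects comes from the fact that every admissible epimorphism
  \<open>\<pi> : L\<^sub>q(\<nu>) \<rightarrow> L\<^sub>r(\<rho>)\<close> is a retraction: it has a section \<open>\<sigma>\<close>, again a module homomorphism, with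
  \<open>\<parallel>\<sigma> (\<pi> x)\<parallel> \<le> \<parallel>x\<parallel>\<close> for every \<open>x\<close>. A morphism \<open>\<phi> : P \<rightarrow> L\<^sub>r(\<rho>)\<close> then lifts to \<open>\<sigma> \<phi>\<close>, whatever \<open>P\<close>
  is. The norm of \<open>\<sigma> y\<close> is bounded by the norm of every preimage of \<open>y\<close>, so it inherits whatever
  the epimorphism guarantees about preimages: \<open>\<parallel>\<sigma> y\<parallel> \<le> c \<parallel>y\<parallel>\<close> from topological surjectivity,
  \<open>\<parallel>\<sigma> y\<parallel> \<le> \<parallel>y\<parallel>\<close> from strict coisometry and, letting \<open>c' \<rightarrow> 1\<close>, also from coisometry.

  The section is multiplication of a preimage by the indicator function of a set \<open>S\<close>. Total
  variations are finite (\<open>finite_measure_total_variation\<close>), so \<open>1 \<in> L\<^sub>r(\<rho>)\<close> and \<open>1 = \<pi> z\<close> for some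
  \<open>z\<close>. A \<open>\<nu>\<close>-null set \<open>A\<close> is \<open>\<rho>\<close>-null, because \<open>1\<^sub>A = \<pi> (1\<^sub>A z) = \<pi> 0 = 0\<close>; hence \<open>\<rho>\<close> has a density \<open>h\<close>
  with respect to \<open>\<nu>\<close>, and \<open>S = {h > 0}\<close> carries \<open>\<rho>\<close>, while \<open>\<nu>\<close> and \<open>\<rho>\<close> have the same null sets
  inside \<open>S\<close>. Elements of the kernel of \<open>\<pi>\<close> vanish on \<open>S\<close>: let \<open>\<pi> d = 0\<close> and
  \<open>A = {\<bar>d\<bar> > 1/k, \<bar>z\<bar> \<le> k}\<close>. The function \<open>w = 1\<^sub>A z / d\<close> is bounded, so
  \<open>1\<^sub>A = \<pi> (1\<^sub>A z) = \<pi> (w d) = w (\<pi> d) = 0\<close>, and \<open>\<rho> A = 0\<close>. Letting \<open>k\<close> grow gives \<open>d = 0\<close> almost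
  everywhere for \<open>\<rho>\<close>, that is, \<open>\<nu>\<close>-almost everywhere on \<open>S\<close> (\<open>onto_hom_kernel\<close>). Therefore
  \<open>x \<mapsto> 1\<^sub>S x\<close> depends on \<open>\<pi> x\<close> only, which defines \<open>\<sigma>\<close> (\<open>module_section\<close>, \<open>Lp_section\<close>).
\<close>

section \<open>Homomorphisms of quasi-normed modules\<close>

text \<open>
  The algebraic half of the argument only uses that modules of operators are again vector spaces and
  that norms separate points. A triangle inequality up to a constant is what makes a sum of bounded
  operators bounded.
\<close>

locale quasi_normed_module =
  fixes M :: "'a measure" and X :: "('a, 'v) fmodule"
  assumes zero_closed: "vzero X \<in> vcarrier X"
    and add_closed: "\<lbrakk>x \<in> vcarrier X; y \<in> vcarrier X\<rbrakk> \<Longrightarrow> vadd X x y \<in> vcarrier X"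
    and scale_closed: "x \<in> vcarrier X \<Longrightarrow> vscale X c x \<in> vcarrier X"
    and act_closed: "\<lbrakk>b \<in> bounded_functions M; x \<in> vcarrier X\<rbrakk> \<Longrightarrow> act X b x \<in> vcarrier X"
    and add_assoc: "\<lbrakk>x \<in> vcarrier X; y \<in> vcarrier X; z \<in> vcarrier X\<rbrakk>
      \<Longrightarrow> vadd X (vadd X x y) z = vadd X x (vadd X y z)"
    and add_commute: "\<lbrakk>x \<in> vcarrier X; y \<in> vcarrier X\<rbrakk> \<Longrightarrow> vadd X x y = vadd X y x"
    and add_zero: "x \<in> vcarrier X \<Longrightarrow> vadd X x (vzero X) = x"
    and scale_add: "\<lbrakk>x \<in> vcarrier X; y \<in> vcarrier X\<rbrakk>
      \<Longrightarrow> vscale X c (vadd X x y) = vadd X (vscale X c x) (vscale X c y)"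
    and scale_plus: "x \<in> vcarrier X
      \<Longrightarrow> vscale X (c + d) x = vadd X (vscale X c x) (vscale X d x)"
    and scale_scale: "x \<in> vcarrier X \<Longrightarrow> vscale X c (vscale X d x) = vscale X (c * d) x"
    and scale_one: "x \<in> vcarrier X \<Longrightarrow> vscale X 1 x = x"
    and scale_zero: "x \<in> vcarrier X \<Longrightarrow> vscale X 0 x = vzero X"
    and act_add: "\<lbrakk>b \<in> bounded_functions M; x \<in> vcarrier X; y \<in> vcarrier X\<rbrakk>
      \<Longrightarrow> act X b (vadd X x y) = vadd X (act X b x) (act X b y)"
    and act_scale: "\<lbrakk>b \<in> bounded_functions M; x \<in> vcarrier X\<rbrakk>
      \<Longrightarrow> act X b (vscale X c x) = vscale X c (act X b x)"
    and act_commute: "\<lbrakk>a \<in> bounded_functions M; b \<in> bounded_functions M; x \<in> vcarrier X\<rbrakk>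
      \<Longrightarrow> act X a (act X b x) = act X b (act X a x)"
    and norm_nonneg: "x \<in> vcarrier X \<Longrightarrow> 0 \<le> vnorm X x"
    and norm_zero: "vnorm X (vzero X) = 0"
    and norm_eq_zero: "\<lbrakk>x \<in> vcarrier X; vnorm X x = 0\<rbrakk> \<Longrightarrow> x = vzero X"
    and norm_scale: "x \<in> vcarrier X \<Longrightarrow> vnorm X (vscale X c x) \<le> cmod c * vnorm X x"
    and norm_add: "\<exists>K\<ge>0. \<forall>x\<in>vcarrier X. \<forall>y\<in>vcarrier X.
      vnorm X (vadd X x y) \<le> K * (vnorm X x + vnorm X y)"
begin

lemma scale_vzero: "vscale X c (vzero X) = vzero X"
  using scale_scale[OF zero_closed, of c 0] scale_zero[OF zero_closed] by simp

lemma act_vzero: "b \<in> bounded_functions M \<Longrightarrow> act X b (vzero X) = vzero X"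
  using act_scale[OF _ zero_closed, of b 0] scale_zero[OF zero_closed] scale_zero act_closed[OF _ zero_closed]
  by simp

lemma add_interchange:
  assumes "x \<in> vcarrier X" "y \<in> vcarrier X" "z \<in> vcarrier X" "w \<in> vcarrier X"
  shows "vadd X (vadd X x y) (vadd X z w) = vadd X (vadd X x z) (vadd X y w)"
proof -
  have "vadd X y (vadd X z w) = vadd X z (vadd X y w)"
    using assms add_assoc[of y z w] add_assoc[of z y w] add_commute[of y z] by simp
  then show ?thesis
    using assms by (simp add: add_assoc add_closed)
qed

lemma eq_if_diff_zero:
  assumes "x \<in> vcarrier X" "y \<in> vcarrier X" "vadd X x (vscale X (-1) y) = vzero X"
  shows "x = y"
proof -
  have "vadd X (vscale X (-1) y) y = vzero X"
    using scale_plus[OF assms(2), of "-1" 1] assms(2) by (simp add: scale_one scale_zero)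
  then have "x = vadd X x (vadd X (vscale X (-1) y) y)"
    using assms by (simp add: add_zero)
  also have "\<dots> = vadd X (vzero X) y"
    using assms by (simp add: add_assoc[symmetric] scale_closed)
  also have "\<dots> = y"
    using assms add_commute zero_closed add_zero by simp
  finally show ?thesis .
qed

end

lemma bounded_opD:
  assumes "bounded_op X Y T"
  shows "x \<in> vcarrier X \<Longrightarrow> T x \<in> vcarrier Y"
    and "\<lbrakk>x \<in> vcarrier X; y \<in> vcarrier X\<rbrakk> \<Longrightarrow> T (vadd X x y) = vadd Y (T x) (T y)"
    and "x \<in> vcarrier X \<Longrightarrow> T (vscale X c x) = vscale Y c (T x)"
  using assms by (auto simp: bounded_op_def)

lemma module_homD:
  assumes "T \<in> module_hom M X Y"
  shows "bounded_op X Y T" "T \<in> vcarrier X \<rightarrow>\<^sub>E vcarrier Y"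
    and "\<lbrakk>b \<in> bounded_functions M; x \<in> vcarrier X\<rbrakk> \<Longrightarrow> T (act X b x) = act Y b (T x)"
  using assms by (auto simp: module_hom_def bounded_op_def)

lemma bounded_op_zero:
  assumes "quasi_normed_module M X" "quasi_normed_module M Y" "bounded_op X Y T"
  shows "T (vzero X) = vzero Y"
proof -
  interpret X: quasi_normed_module M X by fact
  interpret Y: quasi_normed_module M Y by fact
  have "T (vscale X 0 (vzero X)) = vscale Y 0 (T (vzero X))"
    using bounded_opD(3)[OF assms(3)] X.zero_closed by blast
  then show ?thesis
    using bounded_opD(1)[OF assms(3)] X.zero_closed by (simp add: X.scale_zero Y.scale_zero)
qed

lemma bounded_op_bound:
  assumes "quasi_normed_module M X" "bounded_op X Y T"
  obtains C where "C \<ge> 0" "\<And>x. x \<in> vcarrier X \<Longrightarrow> vnorm Y (T x) \<le> C * vnorm X x"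
proof -
  interpret X: quasi_normed_module M X by fact
  obtain C where C: "\<forall>x\<in>vcarrier X. vnorm Y (T x) \<le> C * vnorm X x"
    using assms(2) by (auto simp: bounded_op_def)
  have "vnorm Y (T x) \<le> \<bar>C\<bar> * vnorm X x" if "x \<in> vcarrier X" for x
    using C that mult_right_mono[OF abs_ge_self X.norm_nonneg, of x C] by fastforce
  then show ?thesis
    using that[of "\<bar>C\<bar>"] by simp
qed

lemma vnorm_le_op_norm:
  assumes "quasi_normed_module M X" "bounded_op X Y T" "x \<in> vcarrier X" "vnorm X x \<le> 1"
  shows "vnorm Y (T x) \<le> op_norm X Y T"
proof -
  obtain C where C: "C \<ge> 0" "\<And>x. x \<in> vcarrier X \<Longrightarrow> vnorm Y (T x) \<le> C * vnorm X x"
    using bounded_op_bound[OF assms(1,2)] by blast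
  have "vnorm Y (T x) \<le> C" if "x \<in> vcarrier X" "vnorm X x \<le> 1" for x
    using C(2)[OF that(1)] mult_left_mono[OF that(2) C(1)] by simp
  then have "bdd_above ((\<lambda>x. vnorm Y (T x)) ` {x \<in> vcarrier X. vnorm X x \<le> 1})"
    by (auto intro!: bdd_aboveI2)
  then show ?thesis
    unfolding op_norm_def using assms(3,4) by (intro cSUP_upper) auto
qed

lemma op_norm_least:
  assumes "quasi_normed_module M X"
    and "\<And>x. \<lbrakk>x \<in> vcarrier X; vnorm X x \<le> 1\<rbrakk> \<Longrightarrow> vnorm Y (T x) \<le> c"
  shows "op_norm X Y T \<le> c"
proof -
  interpret X: quasi_normed_module M X by fact
  have "vzero X \<in> {x \<in> vcarrier X. vnorm X x \<le> 1}"
    using X.zero_closed X.norm_zero by simp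
  then show ?thesis
    unfolding op_norm_def using assms(2) by (intro cSUP_least) auto
qed

lemma op_norm_nonneg:
  assumes "quasi_normed_module M X" "quasi_normed_module M Y" "bounded_op X Y T"
  shows "0 \<le> op_norm X Y T"
proof -
  interpret X: quasi_normed_module M X by fact
  interpret Y: quasi_normed_module M Y by fact
  show ?thesis
    using vnorm_le_op_norm[OF assms(1,3) X.zero_closed] bounded_op_zero[OF assms] X.norm_zero Y.norm_zero
    by simp
qed

text \<open>
  The operator norm is defined by the unit ball, so \<open>x\<close> is rescaled to norm 1. If its norm is 0,
  then \<open>x = 0\<close> because norms separate points.
\<close>

lemma vnorm_le_op_norm_mult:
  assumes "quasi_normed_module M X" "quasi_normed_module M Y" "bounded_op X Y T" "x \<in> vcarrier X"
  shows "vnorm Y (T x) \<le> op_norm X Y T * vnorm X x"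
proof -
  interpret X: quasi_normed_module M X by fact
  interpret Y: quasi_normed_module M Y by fact
  show ?thesis
  proof (cases "vnorm X x = 0")
    case True
    then show ?thesis
      using X.norm_eq_zero[OF assms(4)] bounded_op_zero[OF assms(1-3)] Y.norm_zero by simp
  next
    case False
    then have pos: "vnorm X x > 0"
      using X.norm_nonneg[OF assms(4)] by simp
    define n where "n = complex_of_real (vnorm X x)"
    have n: "n \<noteq> 0" "cmod n = vnorm X x"
      using pos by (auto simp: n_def)
    define u where "u = vscale X (1 / n) x"
    have u: "u \<in> vcarrier X" "vscale X n u = x"
      using assms(4) n by (auto simp: u_def X.scale_closed X.scale_scale X.scale_one)
    have "vnorm X u \<le> 1"
      using X.norm_scale[OF assms(4), of "1 / n"] n pos by (simp add: u_def norm_divide)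
    then have le: "vnorm Y (T u) \<le> op_norm X Y T"
      using vnorm_le_op_norm[OF assms(1,3) u(1)] by simp
    have "T x = vscale Y n (T u)"
      using bounded_opD(3)[OF assms(3) u(1), of n] u(2) by simp
    then have "vnorm Y (T x) \<le> vnorm X x * vnorm Y (T u)"
      using Y.norm_scale[of "T u" n] bounded_opD(1)[OF assms(3) u(1)] n by simp
    also have "\<dots> \<le> vnorm X x * op_norm X Y T"
      using le pos by simp
    finally show ?thesis by (simp add: mult.commute)
  qed
qed

lemma module_hom_zero:
  assumes "quasi_normed_module M X" "quasi_normed_module M Y"
  shows "(\<lambda>x\<in>vcarrier X. vzero Y) \<in> module_hom M X Y"
proof -
  interpret X: quasi_normed_module M X by fact
  interpret Y: quasi_normed_module M Y by fact
  show ?thesis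
    by (auto simp: module_hom_def bounded_op_def X.add_closed X.scale_closed X.act_closed
        Y.zero_closed Y.add_zero Y.scale_vzero Y.act_vzero Y.norm_zero intro!: exI[of _ 0])
qed

lemma module_hom_add:
  assumes "quasi_normed_module M X" "quasi_normed_module M Y"
    and "S \<in> module_hom M X Y" "T \<in> module_hom M X Y"
  shows "(\<lambda>x\<in>vcarrier X. vadd Y (S x) (T x)) \<in> module_hom M X Y"
proof -
  interpret X: quasi_normed_module M X by fact
  interpret Y: quasi_normed_module M Y by fact
  note S = module_homD[OF assms(3)] and T = module_homD[OF assms(4)]
  note S' = bounded_opD[OF S(1)] and T' = bounded_opD[OF T(1)]
  obtain C where C: "C \<ge> 0" "\<And>x. x \<in> vcarrier X \<Longrightarrow> vnorm Y (S x) \<le> C * vnorm X x"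
    using bounded_op_bound[OF assms(1) S(1)] by blast
  obtain D where D: "D \<ge> 0" "\<And>x. x \<in> vcarrier X \<Longrightarrow> vnorm Y (T x) \<le> D * vnorm X x"
    using bounded_op_bound[OF assms(1) T(1)] by blast
  obtain K where K: "K \<ge> 0" "\<forall>x\<in>vcarrier Y. \<forall>y\<in>vcarrier Y.
      vnorm Y (vadd Y x y) \<le> K * (vnorm Y x + vnorm Y y)"
    using Y.norm_add by blast
  have "vnorm Y (vadd Y (S x) (T x)) \<le> (K * (C + D)) * vnorm X x" if x: "x \<in> vcarrier X" for x
  proof -
    have "vnorm Y (vadd Y (S x) (T x)) \<le> K * (vnorm Y (S x) + vnorm Y (T x))"
      using K(2) S'(1)[OF x] T'(1)[OF x] by blast
    also have "\<dots> \<le> K * (C * vnorm X x + D * vnorm X x)"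
      using C(2)[OF x] D(2)[OF x] K(1) by (intro mult_left_mono) auto
    finally show ?thesis by (simp add: algebra_simps)
  qed
  then show ?thesis
    unfolding module_hom_def bounded_op_def
    by (auto simp: S(3) T(3) S' T' X.add_closed X.scale_closed X.act_closed
        Y.add_closed Y.add_interchange Y.scale_add Y.act_add)
qed

lemma module_hom_scale:
  assumes "quasi_normed_module M X" "quasi_normed_module M Y" "T \<in> module_hom M X Y"
  shows "(\<lambda>x\<in>vcarrier X. vscale Y c (T x)) \<in> module_hom M X Y"
proof -
  interpret X: quasi_normed_module M X by fact
  interpret Y: quasi_normed_module M Y by fact
  note T = module_homD[OF assms(3)]
  note T' = bounded_opD[OF T(1)]
  obtain C where C: "C \<ge> 0" "\<And>x. x \<in> vcarrier X \<Longrightarrow> vnorm Y (T x) \<le> C * vnorm X x"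
    using bounded_op_bound[OF assms(1) T(1)] by blast
  have "vnorm Y (vscale Y c (T x)) \<le> (cmod c * C) * vnorm X x" if x: "x \<in> vcarrier X" for x
  proof -
    have "vnorm Y (vscale Y c (T x)) \<le> cmod c * vnorm Y (T x)"
      using Y.norm_scale T'(1)[OF x] by blast
    also have "\<dots> \<le> cmod c * (C * vnorm X x)"
      using C(2)[OF x] by (intro mult_left_mono) auto
    finally show ?thesis by (simp add: algebra_simps)
  qed
  moreover have "vscale Y c (vscale Y d (T x)) = vscale Y d (vscale Y c (T x))"
    if "x \<in> vcarrier X" for d x
    using T'(1)[OF that] by (simp add: Y.scale_scale mult.commute)
  ultimately show ?thesis
    unfolding module_hom_def bounded_op_def
    by (auto simp: T(3) T' X.add_closed X.scale_closed X.act_closed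
        Y.scale_closed Y.scale_add Y.act_scale)
qed

lemma module_hom_compose:
  assumes "quasi_normed_module M P" "quasi_normed_module M Y"
    and "S \<in> module_hom M P Y" "T \<in> module_hom M Y X"
  shows "compose (vcarrier P) T S \<in> module_hom M P X"
proof -
  interpret P: quasi_normed_module M P by fact
  note S = module_homD[OF assms(3)] and T = module_homD[OF assms(4)]
  note S' = bounded_opD[OF S(1)] and T' = bounded_opD[OF T(1)]
  obtain C where C: "C \<ge> 0" "\<And>x. x \<in> vcarrier P \<Longrightarrow> vnorm Y (S x) \<le> C * vnorm P x"
    using bounded_op_bound[OF assms(1) S(1)] by blast
  obtain D where D: "D \<ge> 0" "\<And>x. x \<in> vcarrier Y \<Longrightarrow> vnorm X (T x) \<le> D * vnorm Y x"
    using bounded_op_bound[OF assms(2) T(1)] by blast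
  have "vnorm X (T (S x)) \<le> (D * C) * vnorm P x" if x: "x \<in> vcarrier P" for x
    using D(2)[OF S'(1)[OF x]] mult_left_mono[OF C(2)[OF x] D(1)] by (simp add: mult.assoc)
  then show ?thesis
    unfolding module_hom_def bounded_op_def compose_def
    by (auto simp: S(3) T(3) S' T' P.add_closed P.scale_closed P.act_closed)
qed

lemma hom_map_apply:
  "\<psi> \<in> module_hom M P Y \<Longrightarrow> hom_map M P Y \<pi> \<psi> = compose (vcarrier P) \<pi> \<psi>"
  by (simp add: hom_map_def)

text \<open>
  Homomorphisms are extensional functions, and \<open>hom_map\<close> is undefined off \<open>module_hom\<close>. Linearity
  of \<open>\<psi> \<mapsto> \<pi> \<psi>\<close> therefore rests on the closure of \<open>module_hom\<close> under sums and multiples.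
\<close>

lemma hom_map_bounded_op:
  assumes "quasi_normed_module M P" "quasi_normed_module M Y" "quasi_normed_module M X"
    and "\<pi> \<in> module_hom M Y X"
  shows "bounded_op (hom_space M P Y) (hom_space M P X) (hom_map M P Y \<pi>)"
proof -
  note pi = module_homD[OF assms(4)]
  note pi' = bounded_opD[OF pi(1)]
  have in_car: "\<psi> x \<in> vcarrier Y" if "\<psi> \<in> module_hom M P Y" "x \<in> vcarrier P" for \<psi> x
    using bounded_opD(1)[OF module_homD(1)[OF that(1)] that(2)] .
  obtain C where C: "C \<ge> 0" "\<And>x. x \<in> vcarrier Y \<Longrightarrow> vnorm X (\<pi> x) \<le> C * vnorm Y x"
    using bounded_op_bound[OF assms(2) pi(1)] by blast
  have bound: "op_norm P X (compose (vcarrier P) \<pi> \<psi>) \<le> C * op_norm P Y \<psi>"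
    if psi: "\<psi> \<in> module_hom M P Y" for \<psi>
  proof (rule op_norm_least[OF assms(1)])
    fix x assume x: "x \<in> vcarrier P" "vnorm P x \<le> 1"
    have "vnorm X (\<pi> (\<psi> x)) \<le> C * vnorm Y (\<psi> x)"
      using C(2) in_car psi x(1) by blast
    also have "\<dots> \<le> C * op_norm P Y \<psi>"
      using vnorm_le_op_norm[OF assms(1) module_homD(1)[OF psi] x] C(1) by (rule mult_left_mono)
    finally show "vnorm X (compose (vcarrier P) \<pi> \<psi> x) \<le> C * op_norm P Y \<psi>"
      using x(1) by (simp add: compose_eq)
  qed
  show ?thesis
    unfolding bounded_op_def hom_space_def nspace.simps
  proof (intro conjI ballI allI)
    show "hom_map M P Y \<pi> \<in> module_hom M P Y \<rightarrow>\<^sub>E module_hom M P X"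
      using module_hom_compose[OF assms(1,2) _ assms(4)] by (auto simp: hom_map_def)
  next
    fix \<phi> \<psi> assume *: "\<phi> \<in> module_hom M P Y" "\<psi> \<in> module_hom M P Y"
    then show "hom_map M P Y \<pi> (\<lambda>x\<in>vcarrier P. vadd Y (\<phi> x) (\<psi> x)) =
        (\<lambda>x\<in>vcarrier P. vadd X (hom_map M P Y \<pi> \<phi> x) (hom_map M P Y \<pi> \<psi> x))"
      using module_hom_add[OF assms(1,2) *]
      by (auto simp: hom_map_apply compose_def pi' in_car)
  next
    fix c \<psi> assume *: "\<psi> \<in> module_hom M P Y"
    then show "hom_map M P Y \<pi> (\<lambda>x\<in>vcarrier P. vscale Y c (\<psi> x)) =
        (\<lambda>x\<in>vcarrier P. vscale X c (hom_map M P Y \<pi> \<psi> x))"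
      using module_hom_scale[OF assms(1,2) *]
      by (auto simp: hom_map_apply compose_def pi' in_car)
  next
    show "\<exists>C. \<forall>\<psi>\<in>module_hom M P Y. op_norm P X (hom_map M P Y \<pi> \<psi>) \<le> C * op_norm P Y \<psi>"
      using bound by (auto simp: hom_map_apply)
  qed
qed

lemma hom_map_contractive:
  assumes "quasi_normed_module M P" "quasi_normed_module M Y" "quasi_normed_module M X"
    and "\<pi> \<in> contractive_hom M Y X"
  shows "contractive (hom_space M P Y) (hom_space M P X) (hom_map M P Y \<pi>)"
proof -
  have pi: "\<pi> \<in> module_hom M Y X" "bounded_op Y X \<pi>" "op_norm Y X \<pi> \<le> 1"
    using assms(4) by (auto simp: contractive_hom_def contractive_def)
  have *: "op_norm P X (hom_map M P Y \<pi> \<psi>) \<le> 1"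
    if psi: "\<psi> \<in> module_hom M P Y" and le: "op_norm P Y \<psi> \<le> 1" for \<psi>
  proof (rule op_norm_least[OF assms(1)])
    fix x assume x: "x \<in> vcarrier P" "vnorm P x \<le> 1"
    have "vnorm Y (\<psi> x) \<le> 1"
      using vnorm_le_op_norm[OF assms(1) module_homD(1)[OF psi] x] le by simp
    then have "vnorm X (\<pi> (\<psi> x)) \<le> 1"
      using vnorm_le_op_norm[OF assms(2) pi(2), of "\<psi> x"] pi(3)
        bounded_opD(1)[OF module_homD(1)[OF psi] x(1)] by simp
    then show "vnorm X (hom_map M P Y \<pi> \<psi> x) \<le> 1"
      using x(1) psi by (simp add: hom_map_apply compose_eq)
  qed
  \<comment> \<open>The supremum defining the norm of the induced map is over a nonempty set because of the
    zero homomorphism.\<close>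
  have zero: "(\<lambda>x\<in>vcarrier P. vzero Y) \<in> module_hom M P Y"
    using module_hom_zero[OF assms(1,2)] .
  interpret Y: quasi_normed_module M Y by fact
  have "op_norm P Y (\<lambda>x\<in>vcarrier P. vzero Y) \<le> 1"
    using Y.norm_zero by (intro op_norm_least[OF assms(1)]) auto
  with zero * have "op_norm (hom_space M P Y) (hom_space M P X) (hom_map M P Y \<pi>) \<le> 1"
    unfolding op_norm_def[of "hom_space M P Y"]
    by (intro cSUP_least) (auto simp: hom_space_def)
  then show ?thesis
    using hom_map_bounded_op[OF assms(1-3) pi(1)] by (simp add: contractive_def)
qed

text \<open>
  Multiplication by \<open>e\<close> kills the kernel of \<open>\<pi>\<close>, so it factors through \<open>\<pi>\<close>; the second factor is the
  section \<open>\<sigma>\<close>. It is a right inverse because \<open>\<pi> (e x) = e (\<pi> x) = \<pi> x\<close>, and it inherits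
  linearity from the action because any preimage may be used to compute it.
\<close>

lemma module_section:
  assumes "quasi_normed_module M Y" "quasi_normed_module M X"
    and pi: "\<pi> \<in> module_hom M Y X"
    and onto: "\<And>y. y \<in> vcarrier X \<Longrightarrow> \<exists>x\<in>vcarrier Y. \<pi> x = y \<and> vnorm Y x \<le> c * vnorm X y"
    and e: "e \<in> bounded_functions M"
    and kernel: "\<And>x. \<lbrakk>x \<in> vcarrier Y; \<pi> x = vzero X\<rbrakk> \<Longrightarrow> act Y e x = vzero Y"
    and unit: "\<And>y. y \<in> vcarrier X \<Longrightarrow> act X e y = y"
    and shrink: "\<And>x. x \<in> vcarrier Y \<Longrightarrow> vnorm Y (act Y e x) \<le> vnorm Y x"
  obtains \<sigma> where "\<sigma> \<in> module_hom M X Y" "\<And>y. y \<in> vcarrier X \<Longrightarrow> \<pi> (\<sigma> y) = y"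
    "\<And>x. x \<in> vcarrier Y \<Longrightarrow> vnorm Y (\<sigma> (\<pi> x)) \<le> vnorm Y x"
proof -
  interpret Y: quasi_normed_module M Y by fact
  interpret X: quasi_normed_module M X by fact
  note pi1 = module_homD[OF pi]
  note pi2 = bounded_opD[OF pi1(1)]
  have wd: "act Y e x = act Y e x'"
    if x: "x \<in> vcarrier Y" "x' \<in> vcarrier Y" "\<pi> x = \<pi> x'" for x x'
  proof (rule Y.eq_if_diff_zero)
    have "\<pi> (vadd Y x (vscale Y (-1) x')) = vadd X (\<pi> x) (vscale X (-1) (\<pi> x))"
      using x by (simp add: pi2 Y.scale_closed)
    also have "\<dots> = vscale X (1 + -1) (\<pi> x)"
      using pi2(1)[OF x(1)] by (simp only: X.scale_plus X.scale_one)
    also have "\<dots> = vzero X"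
      using pi2(1)[OF x(1)] by (simp add: X.scale_zero)
    finally have "act Y e (vadd Y x (vscale Y (-1) x')) = vzero Y"
      using x by (intro kernel) (auto simp: Y.add_closed Y.scale_closed)
    then show "vadd Y (act Y e x) (vscale Y (-1) (act Y e x')) = vzero Y"
      using x e by (simp add: Y.act_add Y.act_scale Y.scale_closed)
  qed (use x e in \<open>auto simp: Y.act_closed\<close>)
  define \<sigma> where "\<sigma> = (\<lambda>y\<in>vcarrier X. act Y e (SOME x. x \<in> vcarrier Y \<and> \<pi> x = y))"
  have sigma: "\<sigma> (\<pi> x) = act Y e x" if x: "x \<in> vcarrier Y" for x
  proof -
    have "(SOME x'. x' \<in> vcarrier Y \<and> \<pi> x' = \<pi> x) \<in> vcarrier Y
        \<and> \<pi> (SOME x'. x' \<in> vcarrier Y \<and> \<pi> x' = \<pi> x) = \<pi> x"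
      by (rule someI[of _ x]) (use x in simp)
    then have "act Y e (SOME x'. x' \<in> vcarrier Y \<and> \<pi> x' = \<pi> x) = act Y e x"
      using x by (intro wd) auto
    then show ?thesis
      using pi2(1)[OF x] by (simp add: \<sigma>_def)
  qed
  have lift: "\<exists>x\<in>vcarrier Y. \<pi> x = y" if "y \<in> vcarrier X" for y
    using onto[OF that] by blast
  have "\<sigma> \<in> module_hom M X Y"
    unfolding module_hom_def bounded_op_def
  proof (intro CollectI conjI ballI allI)
    show "\<sigma> \<in> vcarrier X \<rightarrow>\<^sub>E vcarrier Y"
    proof (rule PiE_I)
      fix y assume "y \<in> vcarrier X"
      then show "\<sigma> y \<in> vcarrier Y"
        using lift sigma e Y.act_closed by metis
    qed (simp add: \<sigma>_def)
  next
    fix y y' assume "y \<in> vcarrier X" "y' \<in> vcarrier X"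
    then obtain x x' where x: "x \<in> vcarrier Y" "\<pi> x = y" "x' \<in> vcarrier Y" "\<pi> x' = y'"
      using lift by metis
    then have "\<sigma> (\<pi> (vadd Y x x')) = act Y e (vadd Y x x')"
      by (intro sigma) (simp add: Y.add_closed)
    then show "\<sigma> (vadd X y y') = vadd Y (\<sigma> y) (\<sigma> y')"
      using x e sigma[of x] sigma[of x'] by (simp add: pi2 Y.act_add)
  next
    fix d y assume "y \<in> vcarrier X"
    then obtain x where x: "x \<in> vcarrier Y" "\<pi> x = y"
      using lift by metis
    then have "\<sigma> (\<pi> (vscale Y d x)) = act Y e (vscale Y d x)"
      by (intro sigma) (simp add: Y.scale_closed)
    then show "\<sigma> (vscale X d y) = vscale Y d (\<sigma> y)"
      using x e sigma[of x] by (simp add: pi2 Y.act_scale)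
  next
    have "vnorm Y (\<sigma> y) \<le> c * vnorm X y" if y: "y \<in> vcarrier X" for y
    proof -
      obtain x where x: "x \<in> vcarrier Y" "\<pi> x = y" "vnorm Y x \<le> c * vnorm X y"
        using onto[OF y] by blast
      then show ?thesis
        using sigma[OF x(1)] shrink[OF x(1)] by simp
    qed
    then show "\<exists>C. \<forall>y\<in>vcarrier X. vnorm Y (\<sigma> y) \<le> C * vnorm X y"
      by blast
  next
    fix b y assume b: "b \<in> bounded_functions M" and "y \<in> vcarrier X"
    then obtain x where x: "x \<in> vcarrier Y" "\<pi> x = y"
      using lift by metis
    then have "\<sigma> (\<pi> (act Y b x)) = act Y e (act Y b x)"
      using b by (intro sigma) (simp add: Y.act_closed)
    then show "\<sigma> (act X b y) = act Y b (\<sigma> y)"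
      using x e b sigma[of x] Y.act_commute[of e b x] by (simp add: pi1(3))
  qed
  moreover have "\<pi> (\<sigma> y) = y" if y: "y \<in> vcarrier X" for y
  proof -
    obtain x where x: "x \<in> vcarrier Y" "\<pi> x = y"
      using lift[OF y] by blast
    then show ?thesis
      using sigma[OF x(1)] pi1(3)[OF e x(1)] unit[OF y] by simp
  qed
  moreover have "vnorm Y (\<sigma> (\<pi> x)) \<le> vnorm Y x" if "x \<in> vcarrier Y" for x
    using sigma shrink that by simp
  ultimately show thesis
    using that by blast
qed

lemma op_norm_compose_le:
  assumes "quasi_normed_module M P" "\<phi> \<in> module_hom M P X"
    and "\<And>y. y \<in> vcarrier X \<Longrightarrow> vnorm Y (\<sigma> y) \<le> vnorm X y"
  shows "op_norm P Y (compose (vcarrier P) \<sigma> \<phi>) \<le> op_norm P X \<phi>"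
proof (rule op_norm_least[OF assms(1)])
  fix x assume x: "x \<in> vcarrier P" "vnorm P x \<le> 1"
  note phi = module_homD(1)[OF assms(2)]
  show "vnorm Y (compose (vcarrier P) \<sigma> \<phi> x) \<le> op_norm P X \<phi>"
    using vnorm_le_op_norm[OF assms(1) phi x] assms(3)[OF bounded_opD(1)[OF phi x(1)]] x(1)
    by (simp add: compose_eq)
qed

lemma hom_map_section:
  assumes "quasi_normed_module M P" "quasi_normed_module M X"
    and "\<sigma> \<in> module_hom M X Y" "\<And>y. y \<in> vcarrier X \<Longrightarrow> \<pi> (\<sigma> y) = y" "\<phi> \<in> module_hom M P X"
  shows "compose (vcarrier P) \<sigma> \<phi> \<in> module_hom M P Y"
    and "hom_map M P Y \<pi> (compose (vcarrier P) \<sigma> \<phi>) = \<phi>"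
proof -
  show hom: "compose (vcarrier P) \<sigma> \<phi> \<in> module_hom M P Y"
    by (rule module_hom_compose[OF assms(1,2,5,3)])
  have "\<phi> x = compose (vcarrier P) \<pi> (compose (vcarrier P) \<sigma> \<phi>) x" for x
    using assms(4) bounded_opD(1)[OF module_homD(1)[OF assms(5)]]
      PiE_arb[OF module_homD(2)[OF assms(5)], of x]
    by (cases "x \<in> vcarrier P") (auto simp: compose_def)
  then show "hom_map M P Y \<pi> (compose (vcarrier P) \<sigma> \<phi>) = \<phi>"
    using hom by (auto simp: hom_map_apply)
qed


section \<open>The spaces \<open>L\<^sub>p\<close> as quasi-normed modules\<close>

lemma exponent_cases:
  assumes "(1::ennreal) \<le> p"
  obtains "p = top" | "p \<noteq> top" "1 \<le> enn2real p"
proof (cases "p = top")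
  case False
  then have "enn2real 1 \<le> enn2real p"
    using assms by (intro enn2real_mono) (auto simp: top.not_eq_extremum)
  then show ?thesis
    using that False by simp
qed (use that in simp)

lemma lp_functions_measurable [measurable_dest]: "f \<in> lp_functions N p \<Longrightarrow> f \<in> borel_measurable N"
  by (simp add: lp_functions_def)

lemma lp_norm_nonneg: "0 \<le> lp_norm N p f"
  by (simp add: lp_norm_def)

text \<open>
  Scalar multiples, products with bounded functions and changes on a null set are all dominated
  by the original function; this lemma settles integrability and norm estimates for all of them.
\<close>

lemma lp_dominated:
  assumes p: "1 \<le> p" and f: "f \<in> lp_functions N p" and g [measurable]: "g \<in> borel_measurable N"
    and K: "0 \<le> K" and le: "AE x in N. cmod (g x) \<le> K * cmod (f x)"
  shows "g \<in> lp_functions N p" "lp_norm N p g \<le> K * lp_norm N p f"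
proof -
  have f' [measurable]: "f \<in> borel_measurable N"
    using f by (simp add: lp_functions_def)
  show "g \<in> lp_functions N p" "lp_norm N p g \<le> K * lp_norm N p f"
    using p
  proof (atomize (full), cases rule: exponent_cases)
    case 1
    let ?e = "esssup N (\<lambda>x. ennreal (cmod (f x)))"
    have fin: "?e < top"
      using f 1 by (simp add: lp_functions_def)
    have "AE x in N. ennreal (cmod (g x)) \<le> ennreal K * ?e"
      using le esssup_AE[where M=N and f="\<lambda>x. ennreal (cmod (f x))"]
    proof eventually_elim
      case (elim x)
      have "ennreal (cmod (g x)) \<le> ennreal K * ennreal (cmod (f x))"
        using elim(1) K by (simp add: ennreal_mult[symmetric] ennreal_leI)
      also have "\<dots> \<le> ennreal K * ?e"
        using elim(2) by (intro mult_left_mono) auto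
      finally show ?case .
    qed
    then have *: "esssup N (\<lambda>x. ennreal (cmod (g x))) \<le> ennreal K * ?e"
      by (intro esssup_I) auto
    have fin': "ennreal K * ?e < top"
      using fin by (simp add: ennreal_mult_less_top)
    have "enn2real (esssup N (\<lambda>x. ennreal (cmod (g x)))) \<le> K * enn2real ?e"
      using enn2real_mono[OF * fin'] K by (simp add: enn2real_mult)
    then show "g \<in> lp_functions N p \<and> lp_norm N p g \<le> K * lp_norm N p f"
      using 1 le_less_trans[OF * fin'] by (auto simp: lp_functions_def lp_norm_def)
  next
    case 2
    define q where "q = enn2real p"
    have q: "q \<ge> 1"
      using 2 by (simp add: q_def)
    have int_f: "integrable N (\<lambda>x. cmod (f x) powr q)"
      using f 2 by (simp add: lp_functions_def q_def)
    have le': "AE x in N. cmod (g x) powr q \<le> K powr q * cmod (f x) powr q"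
      using le
    proof eventually_elim
      case (elim x)
      then have "cmod (g x) powr q \<le> (K * cmod (f x)) powr q"
        using q by (intro powr_mono2) auto
      then show ?case
        using K by (simp add: powr_mult)
    qed
    have int_g: "integrable N (\<lambda>x. cmod (g x) powr q)"
      by (rule Bochner_Integration.integrable_bound[where f="\<lambda>x. K powr q * cmod (f x) powr q"])
        (use int_f le' in auto)
    have "(LINT x|N. cmod (g x) powr q) \<le> (LINT x|N. K powr q * cmod (f x) powr q)"
      using int_f int_g le' by (intro integral_mono_AE) auto
    then have "(LINT x|N. cmod (g x) powr q) powr (1/q) \<le>
        (K powr q * (LINT x|N. cmod (f x) powr q)) powr (1/q)"
      using q by (intro powr_mono2) auto
    also have "\<dots> = K * (LINT x|N. cmod (f x) powr q) powr (1/q)"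
      using q K by (simp add: powr_mult powr_powr)
    finally show "g \<in> lp_functions N p \<and> lp_norm N p g \<le> K * lp_norm N p f"
      using 2(1) int_g by (simp add: lp_functions_def lp_norm_def q_def)
  qed
qed

lemma lp_norm_cong_AE:
  assumes "1 \<le> p" "f \<in> lp_functions N p" "g \<in> borel_measurable N" "AE x in N. f x = g x"
  shows "g \<in> lp_functions N p" "lp_norm N p f = lp_norm N p g"
proof -
  have "AE x in N. cmod (g x) \<le> 1 * cmod (f x)" "AE x in N. cmod (f x) \<le> 1 * cmod (g x)"
    using assms(4) by auto
  then show g: "g \<in> lp_functions N p" and "lp_norm N p f = lp_norm N p g"
    using lp_dominated[OF assms(1,2,3), of 1] lp_dominated[OF assms(1) _ lp_functions_measurable[OF assms(2)], of g 1]
    by (auto intro: antisym)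
qed

text \<open>
  The constant 4 collects a factor 2 from \<open>\<bar>f + g\<bar> \<le> 2 max \<bar>f\<bar> \<bar>g\<bar>\<close> and a factor 2 from
  \<open>s\<^sup>q + t\<^sup>q \<le> (2 (s + t))\<^sup>q\<close>, where \<open>q \<ge> 1\<close>.
\<close>

lemma lp_add:
  assumes p: "1 \<le> p" and f: "f \<in> lp_functions N p" and g: "g \<in> lp_functions N p"
  shows "(\<lambda>x. f x + g x) \<in> lp_functions N p"
    "lp_norm N p (\<lambda>x. f x + g x) \<le> 4 * (lp_norm N p f + lp_norm N p g)"
proof -
  note [measurable] = lp_functions_measurable[OF f] lp_functions_measurable[OF g]
  show "(\<lambda>x. f x + g x) \<in> lp_functions N p"
    "lp_norm N p (\<lambda>x. f x + g x) \<le> 4 * (lp_norm N p f + lp_norm N p g)"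
    using p
  proof (atomize (full), cases rule: exponent_cases)
    case 1
    let ?e = "\<lambda>f. esssup N (\<lambda>x. ennreal (cmod (f x)))"
    have fin: "?e f < top" "?e g < top"
      using f g 1 by (auto simp: lp_functions_def)
    have "AE x in N. ennreal (cmod (f x + g x)) \<le> ?e f + ?e g"
      using esssup_AE[where M=N and f="\<lambda>x. ennreal (cmod (f x))"] esssup_AE[where M=N and f="\<lambda>x. ennreal (cmod (g x))"]
    proof eventually_elim
      case (elim x)
      have "ennreal (cmod (f x + g x)) \<le> ennreal (cmod (f x)) + ennreal (cmod (g x))"
        by (simp add: ennreal_plus[symmetric] ennreal_leI norm_triangle_ineq del: ennreal_plus)
      then show ?case
        using add_mono[OF elim] by simp
    qed
    then have *: "?e (\<lambda>x. f x + g x) \<le> ?e f + ?e g"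
      by (intro esssup_I) auto
    have fin': "?e f + ?e g < top"
      using fin by simp
    have "enn2real (?e (\<lambda>x. f x + g x)) \<le> enn2real (?e f) + enn2real (?e g)"
      using enn2real_mono[OF * fin'] fin by (simp add: enn2real_plus)
    also have "\<dots> \<le> 4 * (enn2real (?e f) + enn2real (?e g))"
      by (simp add: enn2real_nonneg)
    finally show "(\<lambda>x. f x + g x) \<in> lp_functions N p \<and>
        lp_norm N p (\<lambda>x. f x + g x) \<le> 4 * (lp_norm N p f + lp_norm N p g)"
      using 1 le_less_trans[OF * fin'] by (auto simp: lp_functions_def lp_norm_def)
  next
    case 2
    define q where "q = enn2real p"
    have q: "q \<ge> 1"
      using 2 by (simp add: q_def)
    have pow: "s powr q + t powr q \<le> (2 * (s + t)) powr q" if "0 \<le> s" "0 \<le> t" for s t :: real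
    proof -
      have "s powr q + t powr q \<le> 2 * (s + t) powr q"
        using that q powr_mono2[of q s "s + t"] powr_mono2[of q t "s + t"] by simp
      also have "\<dots> \<le> 2 powr q * (s + t) powr q"
        using q powr_mono[of 1 q "2::real"] by (intro mult_right_mono) auto
      finally show ?thesis
        using that powr_mult[of 2 "s + t" q] by simp
    qed
    have int: "integrable N (\<lambda>x. cmod (f x) powr q)" "integrable N (\<lambda>x. cmod (g x) powr q)"
      using f g 2 by (auto simp: lp_functions_def q_def)
    have le: "cmod (f x + g x) powr q \<le> 2 powr q * (cmod (f x) powr q + cmod (g x) powr q)" for x
    proof -
      have "cmod (f x + g x) \<le> 2 * max (cmod (f x)) (cmod (g x))"
        using norm_triangle_ineq[of "f x" "g x"] by linarith
      then have "cmod (f x + g x) powr q \<le> (2 * max (cmod (f x)) (cmod (g x))) powr q"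
        using q by (intro powr_mono2) auto
      also have "\<dots> = 2 powr q * max (cmod (f x)) (cmod (g x)) powr q"
        by (simp add: powr_mult)
      also have "\<dots> \<le> 2 powr q * (cmod (f x) powr q + cmod (g x) powr q)"
        by (intro mult_left_mono) (auto simp: max_def)
      finally show ?thesis .
    qed
    have int': "integrable N (\<lambda>x. cmod (f x + g x) powr q)"
      by (rule Bochner_Integration.integrable_bound[where
            f="\<lambda>x. 2 powr q * (cmod (f x) powr q + cmod (g x) powr q)"])
        (use int le in \<open>auto simp: AE_I2\<close>)
    let ?n = "\<lambda>f. (LINT x|N. cmod (f x) powr q) powr (1/q)"
    have npow: "(LINT x|N. cmod (f x) powr q) = ?n f powr q" for f :: "'a \<Rightarrow> complex"
      using q by (simp add: powr_powr)
    have "(LINT x|N. cmod (f x + g x) powr q) \<le>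
        (LINT x|N. 2 powr q * (cmod (f x) powr q + cmod (g x) powr q))"
      using int int' le by (intro integral_mono) auto
    also have "\<dots> = 2 powr q * (?n f powr q + ?n g powr q)"
      using int by (simp add: npow[symmetric])
    also have "\<dots> \<le> 2 powr q * (2 * (?n f + ?n g)) powr q"
      by (intro mult_left_mono pow) auto
    also have "\<dots> = (4 * (?n f + ?n g)) powr q"
      by (subst powr_mult[symmetric]) auto
    finally have "?n (\<lambda>x. f x + g x) \<le> ((4 * (?n f + ?n g)) powr q) powr (1/q)"
      using q by (intro powr_mono2) auto
    also have "\<dots> = 4 * (?n f + ?n g)"
      using q by (simp add: powr_powr)
    finally show "(\<lambda>x. f x + g x) \<in> lp_functions N p \<and>
        lp_norm N p (\<lambda>x. f x + g x) \<le> 4 * (lp_norm N p f + lp_norm N p g)"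
      using 2(1) int' by (simp add: lp_functions_def lp_norm_def q_def)
  qed
qed

lemma lp_zero: "(\<lambda>x. 0) \<in> lp_functions N p" "lp_norm N p (\<lambda>x. 0) = 0"
proof -
  have "esssup N (\<lambda>x. 0::ennreal) \<le> 0"
    by (rule esssup_I) auto
  then show "(\<lambda>x. 0) \<in> lp_functions N p" "lp_norm N p (\<lambda>x. 0) = 0"
    by (auto simp: lp_functions_def lp_norm_def)
qed

lemma lp_norm_eq_zero:
  assumes p: "1 \<le> p" and f: "f \<in> lp_functions N p" and zero: "lp_norm N p f = 0"
  shows "AE x in N. f x = 0"
  using p
proof (cases rule: exponent_cases)
  case 1
  then have "esssup N (\<lambda>x. ennreal (cmod (f x))) = 0"
    using f zero by (auto simp: lp_functions_def lp_norm_def enn2real_eq_0_iff)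
  then show ?thesis
    using esssup_AE[where M=N and f="\<lambda>x. ennreal (cmod (f x))"] by simp
next
  case 2
  then have "integrable N (\<lambda>x. cmod (f x) powr enn2real p)"
    and "(LINT x|N. cmod (f x) powr enn2real p) = 0"
    using f zero by (auto simp: lp_functions_def lp_norm_def)
  then have "AE x in N. cmod (f x) powr enn2real p = 0"
    by (subst integral_nonneg_eq_0_iff_AE[symmetric]) auto
  then show ?thesis by simp
qed

lemma lp_const:
  assumes "finite_measure N"
  shows "(\<lambda>x. c) \<in> lp_functions N p"
proof -
  interpret finite_measure N by fact
  have "esssup N (\<lambda>x. ennreal (cmod c)) \<le> ennreal (cmod c)"
    by (rule esssup_I) auto
  then have "esssup N (\<lambda>x. ennreal (cmod c)) < top"
    using le_less_trans by (metis ennreal_less_top)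
  then show ?thesis
    by (auto simp: lp_functions_def)
qed

lemma lp_mult_bounded:
  assumes p: "1 \<le> p" and f: "f \<in> lp_functions N p"
    and sets: "sets N = sets M" and b: "b \<in> bounded_functions M"
  shows "(\<lambda>x. b x * f x) \<in> lp_functions N p"
proof -
  obtain B where B: "\<forall>x\<in>space M. cmod (b x) \<le> B"
    using b by (auto simp: bounded_functions_def bounded_iff)
  have "b \<in> borel_measurable N"
    using b measurable_cong_sets[OF sets refl] by (auto simp: bounded_functions_def)
  then have "(\<lambda>x. b x * f x) \<in> borel_measurable N"
    using lp_functions_measurable[OF f] by measurable
  moreover have "AE x in N. cmod (b x * f x) \<le> \<bar>B\<bar> * cmod (f x)"
  proof (rule AE_I2)
    fix x assume "x \<in> space N"
    then have "cmod (b x) \<le> \<bar>B\<bar>"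
      using B sets_eq_imp_space_eq[OF sets] by fastforce
    then show "cmod (b x * f x) \<le> \<bar>B\<bar> * cmod (f x)"
      by (simp add: norm_mult mult_right_mono)
  qed
  ultimately show ?thesis
    by (rule lp_dominated(1)[OF p f _ abs_ge_zero])
qed

abbreviation Lp_class :: "'a measure \<Rightarrow> ennreal \<Rightarrow> ('a \<Rightarrow> complex) \<Rightarrow> ('a \<Rightarrow> complex) set" where
  "Lp_class N p f \<equiv> ae_rel N p `` {f}"

lemma equiv_ae_rel: "equiv (lp_functions N p) (ae_rel N p)"
proof (rule equivI)
  show "trans (ae_rel N p)"
    by (rule transI) (auto simp: ae_rel_def)
qed (auto simp: ae_rel_def refl_on_def sym_def)

lemma Lp_class_eq_iff:
  assumes "f \<in> lp_functions N p" "g \<in> lp_functions N p"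
  shows "Lp_class N p f = Lp_class N p g \<longleftrightarrow> (AE x in N. f x = g x)"
  using assms eq_equiv_class_iff[OF equiv_ae_rel assms] by (simp add: ae_rel_def)

lemma Lp_class_in_carrier:
  "f \<in> lp_functions N p \<Longrightarrow> Lp_class N p f \<in> vcarrier (Lp_of N p)"
  by (simp add: Lp_of_def quotientI)

lemma Lp_carrierE:
  assumes "F \<in> vcarrier (Lp_of N p)"
  obtains f where "f \<in> lp_functions N p" "F = Lp_class N p f"
  using assms by (auto simp: Lp_of_def elim: quotientE)

lemma Lp_zero: "vzero (Lp_of N p) = Lp_class N p (\<lambda>x. 0)"
  by (simp add: Lp_of_def)

lemma Lp_map_class:
  assumes p: "1 \<le> p" and f: "f \<in> lp_functions N p"
    and h: "\<And>g. g \<in> lp_functions N p \<Longrightarrow> (\<lambda>x. h x * g x) \<in> lp_functions N p"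
  shows "(\<Union>g\<in>Lp_class N p f. Lp_class N p (\<lambda>x. h x * g x)) = Lp_class N p (\<lambda>x. h x * f x)"
proof (rule UN_equiv_class[OF equiv_ae_rel _ f])
  show "(\<lambda>g. Lp_class N p (\<lambda>x. h x * g x)) respects ae_rel N p"
  proof (rule congruentI)
    fix g g' assume "(g, g') \<in> ae_rel N p"
    then show "Lp_class N p (\<lambda>x. h x * g x) = Lp_class N p (\<lambda>x. h x * g' x)"
      by (subst Lp_class_eq_iff) (auto simp: ae_rel_def h)
  qed
qed

lemma Lp_scale:
  assumes "1 \<le> p" "f \<in> lp_functions N p"
  shows "(\<lambda>x. c * f x) \<in> lp_functions N p"
    "lp_norm N p (\<lambda>x. c * f x) \<le> cmod c * lp_norm N p f"
    "vscale (Lp_of N p) c (Lp_class N p f) = Lp_class N p (\<lambda>x. c * f x)"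
proof -
  have *: "(\<lambda>x. c * g x) \<in> lp_functions N p \<and> lp_norm N p (\<lambda>x. c * g x) \<le> cmod c * lp_norm N p g"
    if g: "g \<in> lp_functions N p" for g
    using lp_functions_measurable[OF g] lp_dominated[OF assms(1) g, of "\<lambda>x. c * g x" "cmod c"]
    by (simp add: norm_mult)
  then show "(\<lambda>x. c * f x) \<in> lp_functions N p"
    "lp_norm N p (\<lambda>x. c * f x) \<le> cmod c * lp_norm N p f"
    using assms by auto
  show "vscale (Lp_of N p) c (Lp_class N p f) = Lp_class N p (\<lambda>x. c * f x)"
    unfolding Lp_of_def using Lp_map_class[OF assms, of "\<lambda>_. c"] * by simp
qed

lemma Lp_act:
  assumes "1 \<le> p" "f \<in> lp_functions N p" "sets N = sets M" "b \<in> bounded_functions M"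
  shows "act (Lp_of N p) b (Lp_class N p f) = Lp_class N p (\<lambda>x. b x * f x)"
proof -
  have "(\<Union>g\<in>Lp_class N p f. Lp_class N p (\<lambda>x. b x * g x)) = Lp_class N p (\<lambda>x. b x * f x)"
    by (rule Lp_map_class[OF assms(1,2)]) (rule lp_mult_bounded[OF assms(1) _ assms(3,4)])
  then show ?thesis
    by (simp add: Lp_of_def)
qed

lemma Lp_add:
  assumes p: "1 \<le> p" and f: "f \<in> lp_functions N p" and g: "g \<in> lp_functions N p"
  shows "vadd (Lp_of N p) (Lp_class N p f) (Lp_class N p g) = Lp_class N p (\<lambda>x. f x + g x)"
proof -
  have "(\<lambda>f g. Lp_class N p (\<lambda>x. f x + g x)) respects2 ae_rel N p"
  proof (rule congruent2I[OF equiv_ae_rel equiv_ae_rel])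
    fix f f' g assume *: "(f, f') \<in> ae_rel N p" "g \<in> lp_functions N p"
    show "Lp_class N p (\<lambda>x. f x + g x) = Lp_class N p (\<lambda>x. f' x + g x)"
      by (subst Lp_class_eq_iff) (use * in \<open>auto simp: ae_rel_def lp_add[OF p]\<close>)
  next
    fix f f' g assume *: "(f, f') \<in> ae_rel N p" "g \<in> lp_functions N p"
    show "Lp_class N p (\<lambda>x. g x + f x) = Lp_class N p (\<lambda>x. g x + f' x)"
      by (subst Lp_class_eq_iff) (use * in \<open>auto simp: ae_rel_def lp_add[OF p]\<close>)
  qed
  then show ?thesis
    unfolding Lp_of_def using UN_equiv_class2[OF equiv_ae_rel equiv_ae_rel _ f g] by simp
qed

lemma Lp_norm:
  assumes "1 \<le> p" "f \<in> lp_functions N p"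
  shows "vnorm (Lp_of N p) (Lp_class N p f) = lp_norm N p f"
proof -
  have "lp_norm N p ` Lp_class N p f = {lp_norm N p f}"
  proof -
    have "lp_norm N p g = lp_norm N p f" if "g \<in> Lp_class N p f" for g
      using lp_norm_cong_AE(2)[OF assms, of g] that lp_functions_measurable by (auto simp: ae_rel_def)
    moreover have "f \<in> Lp_class N p f"
      using equiv_class_self[OF equiv_ae_rel assms(2)] .
    ultimately show ?thesis by blast
  qed
  then show ?thesis
    by (simp add: Lp_of_def)
qed

lemma quasi_normed_module_Lp:
  assumes p: "1 \<le> p" and sets: "sets N = sets M"
  shows "quasi_normed_module M (Lp_of N p)"
proof -
  let ?X = "Lp_of N p"
  note [simp] = Lp_add[OF p] Lp_scale(3)[OF p] Lp_act[OF p _ sets] Lp_norm[OF p] Lp_zero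
    Lp_class_in_carrier lp_add(1)[OF p] Lp_scale(1)[OF p] lp_mult_bounded[OF p _ sets] lp_zero
  show ?thesis
  proof
    show "\<exists>K\<ge>0. \<forall>x\<in>vcarrier ?X. \<forall>y\<in>vcarrier ?X. vnorm ?X (vadd ?X x y) \<le> K * (vnorm ?X x + vnorm ?X y)"
      by (rule exI[of _ 4]) (auto elim!: Lp_carrierE intro!: lp_add(2)[OF p, unfolded distrib_left])
  next
    fix x assume "x \<in> vcarrier ?X" and zero: "vnorm ?X x = 0"
    then obtain f where f: "f \<in> lp_functions N p" "x = Lp_class N p f"
      by (auto elim: Lp_carrierE)
    then have "AE x in N. f x = 0"
      using zero by (intro lp_norm_eq_zero[OF p]) auto
    then show "x = vzero ?X"
      using f by (simp add: Lp_class_eq_iff)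
  qed (auto elim!: Lp_carrierE simp: algebra_simps lp_norm_nonneg intro: Lp_scale(2)[OF p])
qed


section \<open>Finiteness of the total variation\<close>

lemma complex_measure_sums:
  assumes "\<mu> \<in> complex_measures M" "range A \<subseteq> sets M" "disjoint_family A"
  shows "(\<lambda>i. \<mu> (A i)) sums \<mu> (\<Union>i. A i)"
  using assms by (auto simp: complex_measures_def)

lemma complex_measure_empty:
  assumes "\<mu> \<in> complex_measures M"
  shows "\<mu> {} = 0"
proof -
  have "(\<lambda>i::nat. \<mu> {}) sums \<mu> {}"
    using complex_measure_sums[OF assms, of "\<lambda>_. {}"] by (simp add: disjoint_family_on_def)
  then show ?thesis
    using sums_summable summable_const_iff by blast
qed

lemma complex_measure_Un:
  assumes "\<mu> \<in> complex_measures M" "A \<in> sets M" "B \<in> sets M" "A \<inter> B = {}"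
  shows "\<mu> (A \<union> B) = \<mu> A + \<mu> B"
proof -
  have d: "disjoint_family (binaryset A B)"
    using assms(4) by (auto simp: disjoint_family_on_def binaryset_def)
  have "(\<lambda>i. \<mu> (binaryset A B i)) sums \<mu> (A \<union> B)"
    using complex_measure_sums[OF assms(1) _ d] assms(2,3)
    by (auto simp: range_binaryset_eq UN_binaryset_eq)
  moreover have "(\<lambda>i. \<mu> (binaryset A B i)) sums (\<mu> A + \<mu> B)"
    using complex_measure_empty[OF assms(1)] by (rule binaryset_sums)
  ultimately show ?thesis
    by (rule sums_unique2)
qed

lemma complex_measure_finite_UN:
  assumes "\<mu> \<in> complex_measures M" "finite I" "\<And>i. i \<in> I \<Longrightarrow> E i \<in> sets M" "disjoint_family_on E I"
  shows "\<mu> (\<Union>i\<in>I. E i) = (\<Sum>i\<in>I. \<mu> (E i))"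
  using assms(2,3,4)
proof (induction I rule: finite_induct)
  case empty
  then show ?case
    using complex_measure_empty[OF assms(1)] by simp
next
  case (insert i I)
  have "\<mu> (E i \<union> (\<Union>j\<in>I. E j)) = \<mu> (E i) + \<mu> (\<Union>j\<in>I. E j)"
    using insert.prems insert.hyps
    by (intro complex_measure_Un[OF assms(1)]) (auto simp: disjoint_family_on_def)
  moreover have "disjoint_family_on E I"
    using insert.prems(2) by (auto simp: disjoint_family_on_def)
  ultimately show ?case
    using insert by simp
qed

text \<open>
  Call a set bad if \<open>\<mu>\<close> is unbounded on its measurable subsets. A bad set \<open>E\<close> contains some \<open>A\<close> with
  \<open>\<bar>\<mu> A\<bar> > \<bar>\<mu> E\<bar> + 1\<close>; then \<open>\<mu>\<close> has modulus at least 1 on both \<open>A\<close> and \<open>E - A\<close>, and one of the two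
  is bad again. If the whole space were bad, splitting repeatedly would give infinitely many disjoint
  sets on which \<open>\<bar>\<mu>\<bar> \<ge> 1\<close>, contradicting the convergence of the series over their union.
\<close>

lemma complex_measure_bounded:
  assumes mu: "\<mu> \<in> complex_measures M"
  obtains K where "\<And>A. A \<in> sets M \<Longrightarrow> cmod (\<mu> A) \<le> K"
proof -
  define bad where "bad E \<longleftrightarrow> E \<in> sets M \<and> \<not> (\<exists>K. \<forall>A\<in>sets M. A \<subseteq> E \<longrightarrow> cmod (\<mu> A) \<le> K)" for E
  have badE: "\<exists>A\<in>sets M. A \<subseteq> E \<and> K < cmod (\<mu> A)" if "bad E" for E K
    using that by (auto simp: bad_def not_le)
  have not_badE: "\<exists>K. \<forall>A\<in>sets M. A \<subseteq> E \<longrightarrow> cmod (\<mu> A) \<le> K" if "\<not> bad E" "E \<in> sets M" for E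
    using that by (simp add: bad_def)
  have split: "\<exists>F. bad F \<and> F \<subseteq> E \<and> cmod (\<mu> (E - F)) \<ge> 1" if E: "bad E" for E
  proof -
    have Es: "E \<in> sets M"
      using E by (simp add: bad_def)
    obtain A where A: "A \<in> sets M" "A \<subseteq> E" "cmod (\<mu> A) > cmod (\<mu> E) + 1"
      using badE[OF E] by blast
    have "\<mu> E = \<mu> A + \<mu> (E - A)"
      using complex_measure_Un[OF mu A(1), of "E - A"] A Es by (simp add: Un_absorb1)
    then have "cmod (\<mu> (E - A)) \<ge> cmod (\<mu> A) - cmod (\<mu> E)"
      using norm_triangle_ineq4[of "\<mu> E" "\<mu> (E - A)"] by simp
    then have big: "cmod (\<mu> (E - A)) \<ge> 1" "cmod (\<mu> A) \<ge> 1"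
      using A(3) norm_ge_zero[of "\<mu> E"] by linarith+
    have "bad A \<or> bad (E - A)"
    proof (rule ccontr)
      assume "\<not> ?thesis"
      then obtain K L where K: "\<forall>B\<in>sets M. B \<subseteq> A \<longrightarrow> cmod (\<mu> B) \<le> K"
        and L: "\<forall>B\<in>sets M. B \<subseteq> E - A \<longrightarrow> cmod (\<mu> B) \<le> L"
        using not_badE[OF _ A(1)] not_badE[OF _ sets.Diff[OF Es A(1)]] by meson
      obtain B where B: "B \<in> sets M" "B \<subseteq> E" "cmod (\<mu> B) > K + L"
        using badE[OF E] by blast
      have "\<mu> B = \<mu> (B \<inter> A) + \<mu> (B - A)"
        using complex_measure_Un[OF mu, of "B \<inter> A" "B - A"] A(1) B(1)
        by (simp add: Int_Diff_Un Int_Diff_disjoint)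
      then have "cmod (\<mu> B) \<le> cmod (\<mu> (B \<inter> A)) + cmod (\<mu> (B - A))"
        by (simp add: norm_triangle_ineq)
      also have "\<dots> \<le> K + L"
        using A(1) B by (intro add_mono K[rule_format] L[rule_format]) auto
      finally show False
        using B(3) by simp
    qed
    then show ?thesis
    proof
      assume "bad A"
      then show ?thesis using A big by blast
    next
      assume "bad (E - A)"
      moreover have "E - (E - A) = A"
        using A(2) by blast
      ultimately show ?thesis using big by (intro exI[of _ "E - A"]) auto
    qed
  qed
  have "\<not> bad (space M)"
  proof
    assume start: "bad (space M)"
    have "\<exists>F. \<forall>n. bad (F n) \<and> (F (Suc n) \<subseteq> F n \<and> cmod (\<mu> (F n - F (Suc n))) \<ge> 1)"
      using start split by (intro dependent_nat_choice) auto
    then obtain F where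
      "\<forall>n. bad (F n) \<and> (F (Suc n) \<subseteq> F n \<and> cmod (\<mu> (F n - F (Suc n))) \<ge> 1)" ..
    then have F: "bad (F n)" "F (Suc n) \<subseteq> F n \<and> cmod (\<mu> (F n - F (Suc n))) \<ge> 1" for n
      by simp_all
    define A where "A n = F n - F (Suc n)" for n
    have mono: "F n \<subseteq> F m" if "m \<le> n" for m n
      by (rule lift_Suc_antimono_le[of F, OF _ that]) (use F(2) in blast)
    have "A m \<inter> A n = {}" if "m < n" for m n
      using mono[of "Suc m" n] that by (auto simp: A_def)
    then have "disjoint_family A"
      unfolding disjoint_family_on_def by (metis Int_commute nat_neq_iff)
    moreover have "range A \<subseteq> sets M"
      using F(1) by (auto simp: A_def bad_def)
    ultimately have "(\<lambda>n. \<mu> (A n)) \<longlonglongrightarrow> 0"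
      using complex_measure_sums[OF mu] sums_summable summable_LIMSEQ_zero by blast
    then have "eventually (\<lambda>n. cmod (\<mu> (A n)) < 1) sequentially"
      using tendstoD[of "\<lambda>n. \<mu> (A n)" 0 sequentially 1] by simp
    then obtain n where "cmod (\<mu> (A n)) < 1"
      using eventually_happens trivial_limit_sequentially by blast
    then show False
      using F(2)[of n] by (simp add: A_def)
  qed
  from not_badE[OF this sets.top]
  obtain K where "\<forall>A\<in>sets M. A \<subseteq> space M \<longrightarrow> cmod (\<mu> A) \<le> K" ..
  then show thesis
    by (intro that[of K]) (simp add: sets.sets_into_space)
qed

text \<open>
  Split the real and the imaginary parts by sign: each of the four resulting sums is, up to
  sign, the real or imaginary part of a partial sum of \<open>z\<close>, hence at most \<open>K\<close>.
\<close>

lemma sum_cmod_le_4: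
  assumes "finite I" "\<And>J. J \<subseteq> I \<Longrightarrow> cmod (\<Sum>i\<in>J. z i) \<le> K"
  shows "(\<Sum>i\<in>I. cmod (z i)) \<le> 4 * K"
proof -
  have real: "(\<Sum>i\<in>I. \<bar>x i\<bar>) \<le> 2 * K" if le: "\<And>J. J \<subseteq> I \<Longrightarrow> \<bar>\<Sum>i\<in>J. x i\<bar> \<le> K" for x :: "'a \<Rightarrow> real"
  proof -
    have "(\<Sum>i\<in>I. \<bar>x i\<bar>) = (\<Sum>i\<in>I. if 0 \<le> x i then x i else 0) - (\<Sum>i\<in>I. if \<not> 0 \<le> x i then x i else 0)"
      unfolding sum_subtractf[symmetric] by (rule sum.cong) auto
    also have "\<dots> = (\<Sum>i\<in>{i\<in>I. 0 \<le> x i}. x i) - (\<Sum>i\<in>{i\<in>I. \<not> 0 \<le> x i}. x i)"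
      using assms(1) by (simp only: sum.inter_filter)
    also have "\<dots> \<le> K + K"
      using le[of "{i\<in>I. 0 \<le> x i}"] le[of "{i\<in>I. \<not> 0 \<le> x i}"] by auto
    finally show ?thesis by simp
  qed
  have "(\<Sum>i\<in>I. \<bar>Re (z i)\<bar>) \<le> 2 * K"
    using assms(2) abs_Re_le_cmod by (intro real) (metis Re_sum order_trans)
  moreover have "(\<Sum>i\<in>I. \<bar>Im (z i)\<bar>) \<le> 2 * K"
    using assms(2) abs_Im_le_cmod by (intro real) (metis Im_sum order_trans)
  moreover have "(\<Sum>i\<in>I. cmod (z i)) \<le> (\<Sum>i\<in>I. \<bar>Re (z i)\<bar> + \<bar>Im (z i)\<bar>)"
    by (intro sum_mono cmod_le)
  ultimately show ?thesis
    by (simp add: sum.distrib)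
qed

lemma sets_total_variation [simp, measurable_cong]: "sets (total_variation M \<mu>) = sets M"
  by (simp add: total_variation_def sets.space_closed sets.sigma_sets_eq)

lemma finite_measure_total_variation:
  assumes mu: "\<mu> \<in> complex_measures M"
  shows "finite_measure (total_variation M \<mu>)"
proof -
  define v where "v A = (SUP E\<in>{E::nat \<Rightarrow> 'a set. range E \<subseteq> sets M \<and> disjoint_family E \<and> (\<Union>i. E i) = A}.
      \<Sum>i. ennreal (cmod (\<mu> (E i))))" for A
  obtain K where K: "\<And>A. A \<in> sets M \<Longrightarrow> cmod (\<mu> A) \<le> K"
    using complex_measure_bounded[OF mu] by blast
  have "(\<Sum>i. ennreal (cmod (\<mu> (E i)))) \<le> ennreal (4 * K)"
    if E: "range E \<subseteq> sets M" "disjoint_family E" for E :: "nat \<Rightarrow> 'a set"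
  proof (rule suminf_le_const)
    fix n
    have "(\<Sum>i<n. cmod (\<mu> (E i))) \<le> 4 * K"
    proof (rule sum_cmod_le_4)
      fix J assume "J \<subseteq> {..<n}"
      then have J: "finite J" "disjoint_family_on E J"
        using E(2) by (auto simp: disjoint_family_on_def intro: finite_subset)
      have "(\<Sum>i\<in>J. \<mu> (E i)) = \<mu> (\<Union>i\<in>J. E i)"
        using complex_measure_finite_UN[OF mu J(1) _ J(2)] E(1) by auto
      then show "cmod (\<Sum>i\<in>J. \<mu> (E i)) \<le> K"
        using J(1) E(1) by (auto intro!: K)
    qed simp
    then show "(\<Sum>i<n. ennreal (cmod (\<mu> (E i)))) \<le> ennreal (4 * K)"
      by (simp add: ennreal_leI)
  qed simp
  then have "v (space M) \<le> ennreal (4 * K)"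
    unfolding v_def by (intro SUP_least) auto
  \<comment> \<open>The value of a measure built by \<^const>\<open>measure_of\<close> is either that of the given set function or 0,
    hence bounded by \<open>v\<close> in both cases.\<close>
  moreover have "emeasure (total_variation M \<mu>) A \<le> v A" if "A \<in> sets M" for A
    using that by (auto simp: total_variation_def v_def[symmetric] emeasure_measure_of_conv sets.sigma_sets_eq)
  moreover have "space (total_variation M \<mu>) = space M"
    by (rule sets_eq_imp_space_eq) simp
  ultimately have "emeasure (total_variation M \<mu>) (space (total_variation M \<mu>)) \<le> ennreal (4 * K)"
    using sets.top[of M] order_trans by metis
  then show ?thesis
    by (intro finite_measureI) (auto simp: top_unique)
qed


section \<open>Epimorphisms between \<open>L\<^sub>p\<close>-modules are retractions\<close>

lemma bounded_functions_indicator: "S \<in> sets M \<Longrightarrow> indicator S \<in> bounded_functions M"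
  by (auto simp: bounded_functions_def bounded_iff indicator_def intro!: exI[of _ 1])

text \<open>
  If \<open>A\<close> is \<open>\<nu>\<close>-null, then \<open>1\<^sub>A z = 0\<close> in \<open>L\<^sub>q(\<nu>)\<close>, and applying \<open>\<pi>\<close> gives \<open>1\<^sub>A = 0\<close> in \<open>L\<^sub>r(\<rho>)\<close>.
\<close>

lemma onto_hom_absolutely_continuous:
  assumes q: "1 \<le> q" and r: "1 \<le> r"
    and nu: "sets \<nu> = sets M" and rho: "sets \<rho> = sets M" "finite_measure \<rho>"
    and pi: "\<pi> \<in> module_hom M (Lp_of \<nu> q) (Lp_of \<rho> r)"
    and z: "z \<in> lp_functions \<nu> q" "\<pi> (Lp_class \<nu> q z) = Lp_class \<rho> r (\<lambda>x. 1)"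
  shows "absolutely_continuous \<nu> \<rho>"
  unfolding absolutely_continuous_def
proof
  fix A assume A: "A \<in> null_sets \<nu>"
  then have A': "A \<in> sets M"
    using nu by auto
  let ?b = "indicator A :: 'a \<Rightarrow> complex"
  have b: "?b \<in> bounded_functions M" "(\<lambda>x. 0) \<in> bounded_functions M"
    using bounded_functions_indicator[OF A'] by (auto simp: bounded_functions_def bounded_iff)
  have one: "(\<lambda>x. 1) \<in> lp_functions \<rho> r"
    using lp_const rho(2) .
  have "Lp_class \<nu> q (\<lambda>x. ?b x * z x) = Lp_class \<nu> q (\<lambda>x. 0 * z x)"
    using AE_not_in[OF A] lp_mult_bounded[OF q z(1) nu] b by (subst Lp_class_eq_iff) (auto simp: lp_zero)
  then have "act (Lp_of \<nu> q) ?b (Lp_class \<nu> q z) = act (Lp_of \<nu> q) (\<lambda>x. 0) (Lp_class \<nu> q z)"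
    using b by (simp add: Lp_act[OF q z(1) nu])
  then have "\<pi> (act (Lp_of \<nu> q) ?b (Lp_class \<nu> q z)) = \<pi> (act (Lp_of \<nu> q) (\<lambda>x. 0) (Lp_class \<nu> q z))"
    by (rule arg_cong)
  then have "act (Lp_of \<rho> r) ?b (Lp_class \<rho> r (\<lambda>x. 1)) = act (Lp_of \<rho> r) (\<lambda>x. 0) (Lp_class \<rho> r (\<lambda>x. 1))"
    by (simp only: module_homD(3)[OF pi _ Lp_class_in_carrier[OF z(1)]] b z(2))
  then have "Lp_class \<rho> r ?b = Lp_class \<rho> r (\<lambda>x. 0)"
    using b by (simp add: Lp_act[OF r one rho(1)])
  then have "AE x in \<rho>. ?b x = 0"
    using lp_mult_bounded[OF r one rho(1) b(1)] by (subst (asm) Lp_class_eq_iff) (auto simp: lp_zero)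
  then have "AE x in \<rho>. x \<notin> A"
    by (auto simp: indicator_eq_0_iff)
  then show "A \<in> null_sets \<rho>"
    using A' rho(1) by (simp add: AE_iff_null_sets)
qed

text \<open>
  On \<open>A = {\<bar>d\<bar> > 1/k, \<bar>z\<bar> \<le> k}\<close> the quotient \<open>z / d\<close> is bounded by \<open>k\<^sup>2\<close>, so \<open>1\<^sub>A z\<close> is a multiple
  of \<open>d\<close> by a bounded function and \<open>\<pi>\<close> maps it to 0. It also maps it to \<open>1\<^sub>A\<close>, hence \<open>\<rho> A = 0\<close>. The
  truncation by \<open>k\<close> is what makes the multiplier an element of the algebra, and these sets exhaust
  \<open>{d \<noteq> 0}\<close>.
\<close>

lemma onto_hom_kernel:
  assumes q: "1 \<le> q" and r: "1 \<le> r"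
    and nu: "sets \<nu> = sets M" and rho: "sets \<rho> = sets M" "finite_measure \<rho>"
    and pi: "\<pi> \<in> module_hom M (Lp_of \<nu> q) (Lp_of \<rho> r)"
    and z: "z \<in> lp_functions \<nu> q" "\<pi> (Lp_class \<nu> q z) = Lp_class \<rho> r (\<lambda>x. 1)"
    and d: "d \<in> lp_functions \<nu> q" "\<pi> (Lp_class \<nu> q d) = Lp_class \<rho> r (\<lambda>x. 0)"
  shows "AE x in \<rho>. d x = 0"
proof -
  have [measurable]: "z \<in> borel_measurable M" "d \<in> borel_measurable M"
    using lp_functions_measurable[OF z(1)] lp_functions_measurable[OF d(1)] measurable_cong_sets[OF nu refl]
    by auto
  have one: "(\<lambda>x. 1) \<in> lp_functions \<rho> r"
    using lp_const rho(2) .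
  have "AE x in \<rho>. \<not> (1 < of_nat k * cmod (d x) \<and> cmod (z x) \<le> of_nat k)" for k :: nat
  proof -
    define A where "A = {x \<in> space M. 1 < real k * cmod (d x) \<and> cmod (z x) \<le> real k}"
    let ?b = "indicator A :: 'a \<Rightarrow> complex"
    let ?w = "\<lambda>x. ?b x * z x / d x"
    have A: "A \<in> sets M"
      unfolding A_def by measurable
    then have b: "?b \<in> bounded_functions M"
      by (rule bounded_functions_indicator)
    have "cmod (?w x) \<le> real k * real k" for x
    proof (cases "x \<in> A")
      case True
      then have dx: "1 < real k * cmod (d x)" and zx: "cmod (z x) \<le> real k"
        by (auto simp: A_def)
      then have pos: "cmod (d x) > 0"
        by (cases "d x = 0") auto
      have "cmod (z x) * 1 \<le> real k * (real k * cmod (d x))"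
        using dx zx by (intro mult_mono) auto
      then show ?thesis
        using True pos by (simp add: norm_divide norm_mult divide_le_eq mult.assoc)
    qed simp
    then have w: "?w \<in> bounded_functions M"
      using A unfolding bounded_functions_def bounded_iff by auto
    have "(\<lambda>x. ?b x * z x) = (\<lambda>x. ?w x * d x)"
      by (auto simp: indicator_def A_def)
    then have "act (Lp_of \<nu> q) ?b (Lp_class \<nu> q z) = act (Lp_of \<nu> q) ?w (Lp_class \<nu> q d)"
      by (simp only: Lp_act[OF q z(1) nu b] Lp_act[OF q d(1) nu w])
    then have "\<pi> (act (Lp_of \<nu> q) ?b (Lp_class \<nu> q z)) = \<pi> (act (Lp_of \<nu> q) ?w (Lp_class \<nu> q d))"
      by (rule arg_cong)
    moreover note homb = module_homD(3)[OF pi b Lp_class_in_carrier[OF z(1)]]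
      and homw = module_homD(3)[OF pi w Lp_class_in_carrier[OF d(1)]]
    ultimately have "act (Lp_of \<rho> r) ?b (Lp_class \<rho> r (\<lambda>x. 1)) = act (Lp_of \<rho> r) ?w (Lp_class \<rho> r (\<lambda>x. 0))"
      by (simp only: homb homw z(2) d(2))
    then have "Lp_class \<rho> r ?b = Lp_class \<rho> r (\<lambda>x. 0)"
      by (simp add: Lp_act[OF r one rho(1) b] Lp_act[OF r lp_zero(1) rho(1) w])
    then have "AE x in \<rho>. ?b x = 0"
      using lp_mult_bounded[OF r one rho(1) b] by (subst (asm) Lp_class_eq_iff) (auto simp: lp_zero)
    then have "AE x in \<rho>. x \<notin> A"
      by (auto simp: indicator_eq_0_iff)
    moreover have "AE x in \<rho>. x \<in> space M"
      using AE_space sets_eq_imp_space_eq[OF rho(1)] by metis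
    ultimately show ?thesis
      by eventually_elim (auto simp: A_def)
  qed
  then have "AE x in \<rho>. \<forall>k::nat. \<not> (1 < of_nat k * cmod (d x) \<and> cmod (z x) \<le> of_nat k)"
    by (simp add: AE_all_countable)
  then show ?thesis
  proof eventually_elim
    case (elim x)
    show ?case
    proof (rule ccontr)
      assume dx: "d x \<noteq> 0"
      obtain k :: nat where k: "max (cmod (z x)) (1 / cmod (d x)) < real k"
        using reals_Archimedean2 by blast
      then have "1 < real k * cmod (d x)" "cmod (z x) \<le> real k"
        using dx by (auto simp: divide_less_eq)
      then show False
        using elim by blast
    qed
  qed
qed

lemma Lp_section:
  assumes q: "1 \<le> q" and r: "1 \<le> r"
    and nu: "sets \<nu> = sets M" "finite_measure \<nu>" and rho: "sets \<rho> = sets M" "finite_measure \<rho>"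
    and pi: "\<pi> \<in> module_hom M (Lp_of \<nu> q) (Lp_of \<rho> r)"
    and onto: "\<And>y. y \<in> vcarrier (Lp_of \<rho> r) \<Longrightarrow>
      \<exists>x\<in>vcarrier (Lp_of \<nu> q). \<pi> x = y \<and> vnorm (Lp_of \<nu> q) x \<le> c * vnorm (Lp_of \<rho> r) y"
  obtains \<sigma> where "\<sigma> \<in> module_hom M (Lp_of \<rho> r) (Lp_of \<nu> q)"
    "\<And>y. y \<in> vcarrier (Lp_of \<rho> r) \<Longrightarrow> \<pi> (\<sigma> y) = y"
    "\<And>x. x \<in> vcarrier (Lp_of \<nu> q) \<Longrightarrow> vnorm (Lp_of \<nu> q) (\<sigma> (\<pi> x)) \<le> vnorm (Lp_of \<nu> q) x"
proof -
  interpret nu: finite_measure \<nu> by fact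
  have one: "(\<lambda>x. 1) \<in> lp_functions \<rho> r"
    using lp_const rho(2) .
  obtain z where z: "z \<in> lp_functions \<nu> q" "\<pi> (Lp_class \<nu> q z) = Lp_class \<rho> r (\<lambda>x. 1)"
    using onto[OF Lp_class_in_carrier[OF one]] Lp_carrierE by metis
  have "absolutely_continuous \<nu> \<rho>"
    using onto_hom_absolutely_continuous[OF q r nu(1) rho pi z] .
  then obtain h where h: "h \<in> borel_measurable \<nu>" "density \<nu> h = \<rho>"
    using nu.Radon_Nikodym nu(1) rho(1) by metis
  \<comment> \<open>\<open>S\<close> carries \<open>\<rho>\<close>, and inside it \<open>\<nu>\<close> and \<open>\<rho>\<close> have the same null sets.\<close>
  define S where "S = {x \<in> space \<nu>. 0 < h x}"
  have S: "S \<in> sets M"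
    using h(1) unfolding nu(1)[symmetric] S_def by measurable
  let ?e = "indicator S :: 'a \<Rightarrow> complex"
  have e: "?e \<in> bounded_functions M"
    using S by (rule bounded_functions_indicator)
  have AE_rho: "(AE x in \<rho>. P x) \<longleftrightarrow> (AE x in \<nu>. x \<in> S \<longrightarrow> P x)" for P
    unfolding h(2)[symmetric] AE_density[OF h(1)] S_def by (rule AE_cong) simp
  show thesis
  proof (rule module_section[OF _ _ pi onto e])
    show "quasi_normed_module M (Lp_of \<nu> q)" "quasi_normed_module M (Lp_of \<rho> r)"
      using quasi_normed_module_Lp q r nu(1) rho(1) by blast+
  next
    fix F assume "F \<in> vcarrier (Lp_of \<nu> q)" and zero: "\<pi> F = vzero (Lp_of \<rho> r)"
    then obtain d where d: "d \<in> lp_functions \<nu> q" "F = Lp_class \<nu> q d"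
      by (auto elim: Lp_carrierE)
    have "AE x in \<rho>. d x = 0"
      using onto_hom_kernel[OF q r nu(1) rho pi z d(1)] zero d(2) by (simp add: Lp_zero)
    then have "AE x in \<nu>. ?e x * d x = 0"
      unfolding AE_rho by eventually_elim (auto simp: indicator_def)
    then show "act (Lp_of \<nu> q) ?e F = vzero (Lp_of \<nu> q)"
      using lp_mult_bounded[OF q d(1) nu(1) e]
      by (simp add: d(2) Lp_act[OF q d(1) nu(1) e] Lp_zero Lp_class_eq_iff lp_zero)
  next
    fix G assume "G \<in> vcarrier (Lp_of \<rho> r)"
    then obtain g where g: "g \<in> lp_functions \<rho> r" "G = Lp_class \<rho> r g"
      by (auto elim: Lp_carrierE)
    have "AE x in \<rho>. ?e x * g x = g x"
      unfolding AE_rho by simp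
    then show "act (Lp_of \<rho> r) ?e G = G"
      using lp_mult_bounded[OF r g(1) rho(1) e]
      by (simp add: g Lp_act[OF r g(1) rho(1) e] Lp_class_eq_iff)
  next
    fix F assume "F \<in> vcarrier (Lp_of \<nu> q)"
    then obtain f where f: "f \<in> lp_functions \<nu> q" "F = Lp_class \<nu> q f"
      by (auto elim: Lp_carrierE)
    note ef = lp_mult_bounded[OF q f(1) nu(1) e]
    have "lp_norm \<nu> q (\<lambda>x. ?e x * f x) \<le> 1 * lp_norm \<nu> q f"
      by (rule lp_dominated(2)[OF q f(1) lp_functions_measurable[OF ef]])
        (auto simp: indicator_def)
    then show "vnorm (Lp_of \<nu> q) (act (Lp_of \<nu> q) ?e F) \<le> vnorm (Lp_of \<nu> q) F"
      using ef by (simp add: f Lp_act[OF q f(1) nu(1) e] Lp_norm[OF q])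
  qed (assumption, rule that)
qed

section \<open>Projectivity\<close>

lemma Lp_objectsE:
  assumes "X \<in> Lp_objects M"
  obtains N p where "X = Lp_of N p" "1 \<le> p" "sets N = sets M" "finite_measure N"
proof -
  obtain p \<mu> where "X = Lp_of (total_variation M \<mu>) p" "1 \<le> p" "\<mu> \<in> complex_measures M"
    using assms by (auto simp: Lp_objects_def Lp_module_def)
  then show thesis
    using that[OF _ _ sets_total_variation finite_measure_total_variation] by simp
qed

lemma quasi_normed_module_Lp_objects: "X \<in> Lp_objects M \<Longrightarrow> quasi_normed_module M X"
  by (auto elim!: Lp_objectsE intro: quasi_normed_module_Lp)

lemma Lp_objects_section:
  assumes "Y \<in> Lp_objects M" "X \<in> Lp_objects M" "\<pi> \<in> module_hom M Y X"
    and "\<And>y. y \<in> vcarrier X \<Longrightarrow> \<exists>x\<in>vcarrier Y. \<pi> x = y \<and> vnorm Y x \<le> c * vnorm X y"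
  obtains \<sigma> where "\<sigma> \<in> module_hom M X Y" "\<And>y. y \<in> vcarrier X \<Longrightarrow> \<pi> (\<sigma> y) = y"
    "\<And>x. x \<in> vcarrier Y \<Longrightarrow> vnorm Y (\<sigma> (\<pi> x)) \<le> vnorm Y x"
proof -
  obtain \<nu> q where Y: "Y = Lp_of \<nu> q" "1 \<le> q" "sets \<nu> = sets M" "finite_measure \<nu>"
    using assms(1) by (rule Lp_objectsE)
  obtain \<rho> r where X: "X = Lp_of \<rho> r" "1 \<le> r" "sets \<rho> = sets M" "finite_measure \<rho>"
    using assms(2) by (rule Lp_objectsE)
  note assms' = assms(3,4)[unfolded X(1) Y(1)] and that' = that[unfolded X(1) Y(1)]
  show thesis
    by (rule Lp_section[OF Y(2) X(2) Y(3,4) X(3,4) assms'(1)]) (erule assms'(2), rule that')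
qed

lemma relatively_projective_Lp:
  assumes P: "P \<in> Lp_objects M"
  shows "relatively_projective M P"
  unfolding relatively_projective_def
proof (intro conjI ballI impI)
  fix Y X \<pi>
  assume YX: "Y \<in> Lp_objects M" "X \<in> Lp_objects M" and pi: "\<pi> \<in> module_hom M Y X"
    and "topologically_surjective Y X \<pi>"
  then obtain c where onto: "\<forall>y\<in>vcarrier X. \<exists>x\<in>vcarrier Y. \<pi> x = y \<and> vnorm Y x \<le> c * vnorm X y"
    unfolding topologically_surjective_def by blast
  obtain \<sigma> where sigma: "\<sigma> \<in> module_hom M X Y" "\<And>y. y \<in> vcarrier X \<Longrightarrow> \<pi> (\<sigma> y) = y"
    by (rule Lp_objects_section[OF YX pi]) (erule bspec[OF onto], rule that)
  note qn = quasi_normed_module_Lp_objects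
  show "hom_map M P Y \<pi> ` module_hom M P Y = module_hom M P X"
  proof (intro equalityI subsetI)
    fix \<phi> assume "\<phi> \<in> hom_map M P Y \<pi> ` module_hom M P Y"
    then show "\<phi> \<in> module_hom M P X"
      using module_hom_compose[OF qn[OF P] qn[OF YX(1)] _ pi] by (auto simp: hom_map_apply)
  next
    fix \<phi> assume "\<phi> \<in> module_hom M P X"
    then show "\<phi> \<in> hom_map M P Y \<pi> ` module_hom M P Y"
      using hom_map_section[OF qn[OF P] qn[OF YX(2)] sigma, of \<phi>] by (metis image_eqI)
  qed
qed (rule P)

lemma metrically_projective_Lp:
  assumes P: "P \<in> Lp_objects M"
  shows "metrically_projective M P"
  unfolding metrically_projective_def
proof (intro conjI ballI impI)
  fix Y X \<pi>
  assume YX: "Y \<in> Lp_objects M" "X \<in> Lp_objects M" and pi: "\<pi> \<in> contractive_hom M Y X"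
    and sc: "strictly_coisometric Y X \<pi>"
  note qn = quasi_normed_module_Lp_objects
  have pi': "\<pi> \<in> module_hom M Y X"
    using pi by (simp add: contractive_hom_def)
  have onto: "\<exists>x\<in>vcarrier Y. \<pi> x = y \<and> vnorm Y x \<le> 1 * vnorm X y" if "y \<in> vcarrier X" for y
    using sc that by (simp add: strictly_coisometric_def)
  obtain \<sigma> where sigma: "\<sigma> \<in> module_hom M X Y" "\<And>y. y \<in> vcarrier X \<Longrightarrow> \<pi> (\<sigma> y) = y"
    and shrink: "\<And>x. x \<in> vcarrier Y \<Longrightarrow> vnorm Y (\<sigma> (\<pi> x)) \<le> vnorm Y x"
    by (rule Lp_objects_section[OF YX pi']) (erule onto, rule that)
  have sigma_le: "vnorm Y (\<sigma> y) \<le> vnorm X y" if y: "y \<in> vcarrier X" for y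
    using onto[OF y] shrink by fastforce
  show "strictly_coisometric (hom_space M P Y) (hom_space M P X) (hom_map M P Y \<pi>)"
    unfolding strictly_coisometric_def
  proof (intro conjI ballI)
    show "contractive (hom_space M P Y) (hom_space M P X) (hom_map M P Y \<pi>)"
      using hom_map_contractive[OF qn[OF P] qn[OF YX(1)] qn[OF YX(2)] pi] .
  next
    fix \<phi> assume "\<phi> \<in> vcarrier (hom_space M P X)"
    then have phi: "\<phi> \<in> module_hom M P X"
      by (simp add: hom_space_def)
    show "\<exists>\<psi>\<in>vcarrier (hom_space M P Y). hom_map M P Y \<pi> \<psi> = \<phi> \<and>
        vnorm (hom_space M P Y) \<psi> \<le> vnorm (hom_space M P X) \<phi>"
      using hom_map_section[OF qn[OF P] qn[OF YX(2)] sigma phi] op_norm_compose_le[OF qn[OF P] phi sigma_le]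
      by (auto simp: hom_space_def)
  qed
qed (rule P)

lemma extremely_projective_Lp:
  assumes P: "P \<in> Lp_objects M"
  shows "extremely_projective M P"
  unfolding extremely_projective_def
proof (intro conjI ballI impI)
  fix Y X \<pi>
  assume YX: "Y \<in> Lp_objects M" "X \<in> Lp_objects M" and pi: "\<pi> \<in> contractive_hom M Y X"
    and co: "coisometric Y X \<pi>"
  note qn = quasi_normed_module_Lp_objects
  interpret Y: quasi_normed_module M Y by (rule qn[OF YX(1)])
  interpret X: quasi_normed_module M X by (rule qn[OF YX(2)])
  have pi': "\<pi> \<in> module_hom M Y X"
    using pi by (simp add: contractive_hom_def)
  have onto: "\<exists>x\<in>vcarrier Y. \<pi> x = y \<and> vnorm Y x \<le> c * vnorm X y"
    if "1 < c" "y \<in> vcarrier X" for c y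
  proof -
    obtain x where x: "x \<in> vcarrier Y" "\<pi> x = y"
      "vnorm Y x < c * vnorm X y \<or> (x = vzero Y \<and> y = vzero X)"
      using co \<open>1 < c\<close> \<open>y \<in> vcarrier X\<close> unfolding coisometric_def by blast
    then have "vnorm Y x \<le> c * vnorm X y"
      by (auto simp: X.norm_zero Y.norm_zero)
    then show ?thesis using x by blast
  qed
  obtain \<sigma> where sigma: "\<sigma> \<in> module_hom M X Y" "\<And>y. y \<in> vcarrier X \<Longrightarrow> \<pi> (\<sigma> y) = y"
    and shrink: "\<And>x. x \<in> vcarrier Y \<Longrightarrow> vnorm Y (\<sigma> (\<pi> x)) \<le> vnorm Y x"
    by (rule Lp_objects_section[OF YX pi']) (rule onto[of 2], simp, assumption, rule that)
  \<comment> \<open>Preimages of norm at most \<open>\<parallel>y\<parallel> / t\<close> exist for every \<open>t < 1\<close>, and one \<open>\<sigma> y\<close> is below all of them.\<close>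
  have sigma_le: "vnorm Y (\<sigma> y) \<le> vnorm X y" if y: "y \<in> vcarrier X" for y
  proof (rule field_le_mult_one_interval)
    fix t :: real assume t: "0 < t" "t < 1"
    then obtain x where x: "x \<in> vcarrier Y" "\<pi> x = y" "vnorm Y x \<le> (1 / t) * vnorm X y"
      using onto[of "1 / t" y] y by auto
    then have "vnorm Y (\<sigma> y) \<le> (1 / t) * vnorm X y"
      using shrink[of x] by simp
    then show "t * vnorm Y (\<sigma> y) \<le> vnorm X y"
      using t by (simp add: field_simps)
  qed
  show "coisometric (hom_space M P Y) (hom_space M P X) (hom_map M P Y \<pi>)"
    unfolding coisometric_def
  proof (intro conjI ballI allI impI)
    show "contractive (hom_space M P Y) (hom_space M P X) (hom_map M P Y \<pi>)"
      using hom_map_contractive[OF qn[OF P] qn[OF YX(1)] qn[OF YX(2)] pi] .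
  next
    fix c' :: real and \<phi> assume c': "1 < c'" and "\<phi> \<in> vcarrier (hom_space M P X)"
    then have phi: "\<phi> \<in> module_hom M P X"
      by (simp add: hom_space_def)
    let ?\<psi> = "compose (vcarrier P) \<sigma> \<phi>"
    have psi: "?\<psi> \<in> module_hom M P Y" "hom_map M P Y \<pi> ?\<psi> = \<phi>" "op_norm P Y ?\<psi> \<le> op_norm P X \<phi>"
      using hom_map_section[OF qn[OF P] qn[OF YX(2)] sigma phi] op_norm_compose_le[OF qn[OF P] phi sigma_le]
      by auto
    \<comment> \<open>The strict inequality needs \<open>\<phi>\<close> to have positive norm; otherwise \<open>\<phi>\<close> and its lift vanish.\<close>
    have "op_norm P Y ?\<psi> < c' * op_norm P X \<phi> \<or>
        (?\<psi> = (\<lambda>x\<in>vcarrier P. vzero Y) \<and> \<phi> = (\<lambda>x\<in>vcarrier P. vzero X))"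
    proof (cases "op_norm P X \<phi> = 0")
      case True
      have zero: "\<phi> x = vzero X" if x: "x \<in> vcarrier P" for x
      proof (rule X.norm_eq_zero)
        show "\<phi> x \<in> vcarrier X"
          using bounded_opD(1)[OF module_homD(1)[OF phi] x] .
        then show "vnorm X (\<phi> x) = 0"
          using vnorm_le_op_norm_mult[OF qn[OF P] qn[OF YX(2)] module_homD(1)[OF phi] x] True
            X.norm_nonneg[of "\<phi> x"] by simp
      qed
      have "\<sigma> (vzero X) = vzero Y"
        using bounded_op_zero[OF qn[OF YX(2)] qn[OF YX(1)] module_homD(1)[OF sigma(1)]] .
      then have "?\<psi> = (\<lambda>x\<in>vcarrier P. vzero Y)"
        using zero by (simp add: compose_def cong: restrict_cong)
      moreover have "\<phi> = (\<lambda>x\<in>vcarrier P. vzero X)"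
        using zero PiE_arb[OF module_homD(2)[OF phi]] by (simp add: restrict_def fun_eq_iff)
      ultimately show ?thesis by blast
    next
      case False
      then have "0 < op_norm P X \<phi>"
        using op_norm_nonneg[OF qn[OF P] qn[OF YX(2)] module_homD(1)[OF phi]] by simp
      then have "1 * op_norm P X \<phi> < c' * op_norm P X \<phi>"
        by (rule mult_strict_right_mono[OF c'])
      then show ?thesis
        using psi(3) by linarith
    qed
    then show "\<exists>\<psi>\<in>vcarrier (hom_space M P Y). hom_map M P Y \<pi> \<psi> = \<phi> \<and>
        (vnorm (hom_space M P Y) \<psi> < c' * vnorm (hom_space M P X) \<phi> \<or>
         (\<psi> = vzero (hom_space M P Y) \<and> \<phi> = vzero (hom_space M P X)))"
      using psi(1,2) by (auto simp: hom_space_def intro!: bexI[of _ ?\<psi>])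
  qed
qed (rule P)

theorem theorem3p3p2:
  fixes M :: "'a measure" and p :: ennreal and \<mu> :: "'a set \<Rightarrow> complex"
  assumes "1 \<le> p" and "\<mu> \<in> complex_measures M"
  shows "relatively_projective M (Lp_module M p \<mu>) \<and>
         metrically_projective M (Lp_module M p \<mu>) \<and>
         extremely_projective M (Lp_module M p \<mu>)"
proof -
  have "Lp_module M p \<mu> \<in> Lp_objects M"
    using assms by (auto simp: Lp_objects_def)
  then show ?thesis
    by (simp add: relatively_projective_Lp metrically_projective_Lp extremely_projective_Lp)
qed

end
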